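(* Let $G\subset\mathrm{Heis}(3,\mathbb{C})$ be a discrete group. Then $G$ is purely parabolic and: (1) There are subgroups $B_1,\dots,B_n$ of $G$ such that $G=\mathrm{Ker}(\Pi|_G)\rtimes B_1\rtimes\cdots\rtimes B_n$ and each $B_i$ is isomorphic to $\mathbb{Z}^{k_i}$ for some $k_i\in\mathbb{N}\cup\{0\}$. (2) $\mathrm{rank}(\mathrm{Ker}(\Pi|_G))+\sum_{i=1}^n k_i\le 6$. (3) If $G$ is complex Kleinian, then $\mathrm{rank}(\mathrm{Ker}(\Pi|_G))+\sum_{i=1}^n k_i\le 4$.
   Context: $\mathrm{Heis}(3,\mathbb{C})\subset\mathrm{PSL}(3,\mathbb{C})$ is the group of classes of matrices $\left[\begin{smallmatrix}1&a&b\\0&1&c\\0&0&1\end{smallmatrix}\right]$, $a,b,c\in\mathbb{C}$, acting on $\mathbb{P}^2_{\mathbb{C}}$. $\Pi$ is the control morphism with respect to the common fixed point $e_1=[1:0:0]$: it is the homomorphism to $\mathrm{PSL}(2,\mathbb{C})$ given by the induced action on the pencil of lines through $e_1$, i.e. it sends the matrix above to $\left[\begin{smallmatrix}1&c\\0&1\end{smallmatrix}\right]$ (the translation by $c$). An element of $\mathrm{PSL}(3,\mathbb{C})$ is parabolic if its lifts to $\mathrm{SL}(3,\mathbb{C})$ are non-diagonalizable with all eigenvalues of modulus $1$; a group is purely parabolic if all its elements other than the identity are parabolic. The rank of a group is the smallest number of elements generating it. $G$ is complex Kleinian if it is discrete and there is a non-empty open $G$-invariant set $\Omega\subset\mathbb{P}^2_{\mathbb{C}}$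 on which $G$ acts properly discontinuously (for each compact $K\subset\Omega$ the set $\{g\in G:g(K)\cap K\ne\emptyset\}$ is finite). Iterated semidirect products are bracketed from the left: $(\cdots((\mathrm{Ker}(\Pi|_G)\rtimes B_1)\rtimes B_2)\cdots)\rtimes B_n$. *)

theory Defs
  imports
    "HOL-Analysis.Analysis"
    "HOL-Algebra.Elementary_Groups"
    "HOL-Algebra.Product_Groups"
    "HOL-Algebra.Generated_Groups"
    "HOL-Library.Extended_Nat"
begin

section \<open>The groups SL(n,C) and PSL(n,C)\<close>

definition SL :: "(complex^'n^'n) monoid" where
  "SL = \<lparr>carrier = {A. det A = 1}, monoid.mult = (\<lambda>A B. A ** B), one = mat 1\<rparr>"

definition scalars :: "(complex^'n^'n) set" where
  "scalars = {A. det A = 1 \<and> (\<exists>c. A = mat c)}"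

text \<open>An element of PSL(n,C) is the set of all its lifts to SL(n,C).\<close>

definition PSL :: "(complex^'n^'n) set monoid" where
  "PSL = SL Mod scalars"

definition psl_class :: "complex^'n^'n \<Rightarrow> (complex^'n^'n) set" where
  "psl_class A = scalars #>\<^bsub>SL\<^esub> A"

lemma SL_simps [simp]:
  "carrier SL = {A. det A = 1}" "A \<otimes>\<^bsub>SL\<^esub> B = A ** B" "\<one>\<^bsub>SL\<^esub> = mat 1"
  by (simp_all add: SL_def)

lemma mat_mult_left: "(mat c ** A :: complex^'n^'n) = (\<chi> i j. c * A $ i $ j)"
  by (simp add: matrix_matrix_mult_def mat_def vec_eq_iff if_distrib[of "\<lambda>x. x * _"] sum.delta cong: if_cong)

lemma mat_mult_right: "(A ** mat c :: complex^'n^'n) = (\<chi> i j. c * A $ i $ j)"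
  by (simp add: matrix_matrix_mult_def mat_def vec_eq_iff if_distrib[of "\<lambda>x. _ * x"] sum.delta' mult.commute cong: if_cong)

lemma mat_mult_mat: "(mat c ** mat d :: complex^'n^'n) = mat (c * d)"
  by (simp only: mat_mult_left) (simp add: mat_def vec_eq_iff)

lemma group_SL: "group (SL :: (complex^'n^'n) monoid)"
proof (rule groupI)
  fix A :: "complex^'n^'n" assume "A \<in> carrier SL"
  then have "det A = 1" by simp
  then have "invertible A" by (simp add: invertible_det_nz)
  then have B: "matrix_inv A ** A = mat 1"
    unfolding invertible_def matrix_inv_def by (rule someI2_ex) auto
  then have "det (matrix_inv A) * det A = 1" by (metis det_mul det_I)
  with B \<open>det A = 1\<close> show "\<exists>y\<in>carrier SL. y \<otimes>\<^bsub>SL\<^esub> A = \<one>\<^bsub>SL\<^esub>" by auto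
qed (auto simp: det_mul matrix_mul_assoc)

lemma scalars_normal: "(scalars :: (complex^'n^'n) set) \<lhd> SL"
proof -
  interpret group "SL :: (complex^'n^'n) monoid" by (rule group_SL)
  have sub: "subgroup (scalars :: (complex^'n^'n) set) SL"
  proof
    show "scalars \<subseteq> carrier (SL :: (complex^'n^'n) monoid)" by (auto simp: scalars_def)
    show "\<one>\<^bsub>SL\<^esub> \<in> (scalars :: (complex^'n^'n) set)" by (auto simp: scalars_def)
  next
    fix x y :: "complex^'n^'n" assume "x \<in> scalars" "y \<in> scalars"
    then show "x \<otimes>\<^bsub>SL\<^esub> y \<in> scalars" by (auto simp: scalars_def det_mul mat_mult_mat)
  next
    fix x :: "complex^'n^'n" assume x: "x \<in> scalars"
    then obtain c where c: "x = mat c" "c ^ CARD('n) = 1"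
      by (auto simp: scalars_def mat_def det_diagonal)
    then have c0: "c \<noteq> 0" by (auto simp: power_0_left)
    have "det (mat (inverse c) :: complex^'n^'n) = 1"
      using c by (simp add: mat_def det_diagonal power_inverse)
    moreover from this have "inv\<^bsub>SL\<^esub> x = mat (inverse c)"
      using x c c0 by (intro inv_equality) (auto simp: mat_mult_mat scalars_def)
    ultimately show "inv\<^bsub>SL\<^esub> x \<in> scalars" by (auto simp: scalars_def)
  qed
  show ?thesis
    using sub by (rule normalI)
      (auto simp: r_coset_def l_coset_def scalars_def mat_mult_left mat_mult_right)
qed

lemma group_PSL: "group (PSL :: (complex^'n^'n) set monoid)"
  unfolding PSL_def by (rule normal.factorgroup_is_group[OF scalars_normal])

section \<open>Topology of PSL(n,C) and of projective space\<close>

definition quotient_topology :: "'a topology \<Rightarrow> ('a \<Rightarrow> 'b) \<Rightarrow> 'b topology" where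
  "quotient_topology X f =
     topology (\<lambda>V. V \<subseteq> f ` topspace X \<and> openin X {x \<in> topspace X. f x \<in> V})"

lemma openin_quotient_topology:
  "openin (quotient_topology X f) V \<longleftrightarrow>
     V \<subseteq> f ` topspace X \<and> openin X {x \<in> topspace X. f x \<in> V}"
proof -
  have "istopology (\<lambda>V. V \<subseteq> f ` topspace X \<and> openin X {x \<in> topspace X. f x \<in> V})"
    unfolding istopology_def
  proof (intro conjI allI impI; (elim conjE)?)
    fix S T assume "openin X {x \<in> topspace X. f x \<in> S}" "openin X {x \<in> topspace X. f x \<in> T}"
    then have "openin X ({x \<in> topspace X. f x \<in> S} \<inter> {x \<in> topspace X. f x \<in> T})" by blast
    then show "openin X {x \<in> topspace X. f x \<in> S \<inter> T}" by (simp add: Int_def conj_ac cong: conj_cong)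
  next
    fix K assume "\<forall>S\<in>K. S \<subseteq> f ` topspace X \<and> openin X {x \<in> topspace X. f x \<in> S}"
    then have "openin X (\<Union>S\<in>K. {x \<in> topspace X. f x \<in> S})" by blast
    moreover have "(\<Union>S\<in>K. {x \<in> topspace X. f x \<in> S}) = {x \<in> topspace X. f x \<in> \<Union>K}" by blast
    ultimately show "openin X {x \<in> topspace X. f x \<in> \<Union>K}" by simp
  qed blast+
  then show ?thesis by (simp add: quotient_topology_def)
qed

lemma topspace_quotient_topology [simp]: "topspace (quotient_topology X f) = f ` topspace X"
proof (rule antisym)
  show "topspace (quotient_topology X f) \<subseteq> f ` topspace X"
    by (metis openin_quotient_topology openin_topspace)
  have "{x \<in> topspace X. f x \<in> f ` topspace X} = topspace X" by blast
  then have "openin (quotient_topology X f) (f ` topspace X)"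
    by (simp add: openin_quotient_topology)
  then show "f ` topspace X \<subseteq> topspace (quotient_topology X f)" by (rule openin_subset)
qed

lemma quotient_map_quotient_topology: "quotient_map X (quotient_topology X f) f"
  by (auto simp: quotient_map_def openin_quotient_topology)

definition PSL_topology :: "(complex^'n^'n) set topology" where
  "PSL_topology = quotient_topology (top_of_set (carrier SL)) psl_class"

lemma topspace_PSL_topology: "topspace PSL_topology = carrier PSL"
  by (auto simp: PSL_topology_def PSL_def FactGroup_def RCOSETS_def psl_class_def)

definition discrete_group :: "(complex^'n^'n) set set \<Rightarrow> bool" where
  "discrete_group G \<longleftrightarrow> subtopology PSL_topology G = discrete_topology G"

text \<open>Points of projective space are the one-dimensional linear subspaces of \<open>\<complex>\<^sup>n\<close>
  (\<open>vec.span\<close> is the complex span).\<close>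

definition proj_space :: "(complex^'n) set topology" where
  "proj_space = quotient_topology (top_of_set (UNIV - {0})) (\<lambda>v. vec.span {v})"

text \<open>All lifts of \<open>g\<close> map a linear subspace \<open>p\<close> to the same subspace, so the union
  is just the image of \<open>p\<close> under any one of them.\<close>

definition psl_act :: "(complex^'n^'n) set \<Rightarrow> (complex^'n) set \<Rightarrow> (complex^'n) set" where
  "psl_act g p = (\<Union>A\<in>g. (\<lambda>v. A *v v) ` p)"

lemma psl_act_psl_class:
  assumes "vec.subspace p"
  shows "psl_act (psl_class A) p = (\<lambda>v. A *v v) ` p"
proof -
  have act: "(mat c ** A) *v v = A *v (c *s v)" for c v
    by (simp add: mat_mult_left matrix_vector_mult_def vec_eq_iff sum_distrib_left mult_ac)
  have one: "mat 1 \<in> (scalars :: (complex^'a^'a) set)" by (auto simp: scalars_def)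
  show ?thesis
    unfolding psl_act_def psl_class_def r_coset_def
  proof (intro equalityI subsetI)
    fix w assume "w \<in> (\<Union>B\<in>\<Union>h\<in>scalars. {h \<otimes>\<^bsub>SL\<^esub> A}. (*v) B ` p)"
    then obtain c v where "v \<in> p" "w = (mat c ** A) *v v" by (auto simp: scalars_def)
    then show "w \<in> (*v) A ` p" using act vec.subspace_scale[OF assms] by auto
  next
    fix w assume "w \<in> (*v) A ` p"
    then show "w \<in> (\<Union>B\<in>\<Union>h\<in>scalars. {h \<otimes>\<^bsub>SL\<^esub> A}. (*v) B ` p)"
      using one by (auto intro!: bexI[of _ "mat 1"])
  qed
qed

section \<open>Parabolic elements, rank, Kleinian groups\<close>

definition diagonalizable :: "complex^'n^'n \<Rightarrow> bool" where
  "diagonalizable A \<longleftrightarrow>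
     (\<exists>P D :: complex^'n^'n. invertible P \<and> (\<forall>i j. i \<noteq> j \<longrightarrow> D $ i $ j = 0) \<and> A = P ** D ** matrix_inv P)"

definition eigenvalue :: "complex^'n^'n \<Rightarrow> complex \<Rightarrow> bool" where
  "eigenvalue A c \<longleftrightarrow> (\<exists>v. v \<noteq> 0 \<and> A *v v = c *s v)"

definition parabolic :: "(complex^'n^'n) set \<Rightarrow> bool" where
  "parabolic g \<longleftrightarrow>
     (\<forall>A\<in>g. \<not> diagonalizable A \<and> (\<forall>c. eigenvalue A c \<longrightarrow> cmod c = 1))"

definition purely_parabolic :: "(complex^'n^'n) set set \<Rightarrow> bool" where
  "purely_parabolic G \<longleftrightarrow> (\<forall>g\<in>G. g \<noteq> \<one>\<^bsub>PSL\<^esub> \<longrightarrow> parabolic g)"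

text \<open>The rank is \<open>\<infinity>\<close> if \<open>H\<close> is not finitely generated.\<close>

definition group_rank :: "('a, 'b) monoid_scheme \<Rightarrow> 'a set \<Rightarrow> enat" where
  "group_rank Gr H = Inf {enat (card S) |S. finite S \<and> S \<subseteq> H \<and> generate Gr S = H}"

definition properly_discontinuous_on ::
    "(complex^'n^'n) set set \<Rightarrow> (complex^'n) set set \<Rightarrow> bool" where
  "properly_discontinuous_on G \<Omega> \<longleftrightarrow>
     (\<forall>K. compactin proj_space K \<and> K \<subseteq> \<Omega> \<longrightarrow> finite {g \<in> G. psl_act g ` K \<inter> K \<noteq> {}})"

definition complex_Kleinian :: "(complex^3^3) set set \<Rightarrow> bool" where
  "complex_Kleinian G \<longleftrightarrow> discrete_group G \<and>
     (\<exists>\<Omega>. \<Omega> \<noteq> {} \<and> openin proj_space \<Omega> \<and> (\<forall>g\<in>G. psl_act g ` \<Omega> = \<Omega>) \<and>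
          properly_discontinuous_on G \<Omega>)"

section \<open>Semidirect products and free abelian groups\<close>

definition semidirect :: "('a, 'b) monoid_scheme \<Rightarrow> 'a set \<Rightarrow> 'a set \<Rightarrow> 'a set \<Rightarrow> bool" where
  "semidirect Gr N B H \<longleftrightarrow> subgroup H Gr \<and> N \<lhd> (Gr\<lparr>carrier := H\<rparr>) \<and>
     subgroup B (Gr\<lparr>carrier := H\<rparr>) \<and> N \<inter> B = {\<one>\<^bsub>Gr\<^esub>} \<and> N <#>\<^bsub>Gr\<^esub> B = H"

text \<open>\<open>iterated_semidirect Gr N B n H\<close> says \<open>H = (\<cdots>(N \<rtimes> B 1) \<rtimes> \<cdots>) \<rtimes> B n\<close>.\<close>

primrec iterated_semidirect ::
    "('a, 'b) monoid_scheme \<Rightarrow> 'a set \<Rightarrow> (nat \<Rightarrow> 'a set) \<Rightarrow> nat \<Rightarrow> 'a set \<Rightarrow> bool" where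
  "iterated_semidirect Gr N B 0 H \<longleftrightarrow> H = N"
| "iterated_semidirect Gr N B (Suc n) H \<longleftrightarrow>
     (\<exists>M. iterated_semidirect Gr N B n M \<and> semidirect Gr M (B (Suc n)) H)"

definition Z_power :: "nat \<Rightarrow> (nat \<Rightarrow> int) monoid" where
  "Z_power k = product_group {..<k} (\<lambda>_. integer_group)"

section \<open>The Heisenberg group and the control morphism\<close>

definition heis :: "complex \<Rightarrow> complex \<Rightarrow> complex \<Rightarrow> complex^3^3" where
  "heis a b c = vector [vector [1, a, b], vector [0, 1, c], vector [0, 0, 1]]"

definition Heis :: "(complex^3^3) set set" where
  "Heis = {psl_class (heis a b c) |a b c. True}"

definition lower_block :: "complex^3^3 \<Rightarrow> complex^2^2" where
  "lower_block A = vector [vector [A $ 2 $ 2, A $ 2 $ 3], vector [A $ 3 $ 2, A $ 3 $ 3]]"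

text \<open>A lift \<open>A\<close> of an element fixing \<open>[1:0:0]\<close> acts on \<open>\<complex>\<^sup>3 / \<langle>e\<^sub>1\<rangle>\<close>, whose projectivization is
  the pencil of lines through \<open>[1:0:0]\<close>, by its lower right 2x2 block. That block need not have
  determinant 1, so the lifts to SL(2,C) of the induced projective map are the matrices
  of determinant 1 proportional to it.\<close>

definition control :: "(complex^3^3) set \<Rightarrow> (complex^2^2) set" where
  "control g = {B. det B = 1 \<and> (\<exists>A\<in>g. \<exists>\<mu>. lower_block A = mat \<mu> ** B)}"

definition control_kernel :: "(complex^3^3) set set \<Rightarrow> (complex^3^3) set set" where
  "control_kernel G = kernel (PSL\<lparr>carrier := G\<rparr>) PSL control"

definition transl :: "complex \<Rightarrow> complex^2^2" where
  "transl c = vector [vector [1, c], vector [0, 1]]"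

lemma control_heis: "control (psl_class (heis a b c)) = psl_class (transl c)"
proof -
  have det_t: "det (transl c) = 1" by (simp add: transl_def det_2 vector_2)
  have lb: "lower_block (mat d ** heis a b c) = mat d ** transl c" for d
    by (simp add: lower_block_def heis_def transl_def mat_mult_left vec_eq_iff forall_2 vector_2 vector_3)
  have lb1: "lower_block (heis a b c) = transl c"
    using lb[of 1] by simp
  have dm: "det (mat d :: complex^'n^'n) = d ^ CARD('n)" for d
    by (simp add: mat_def det_diagonal)
  show ?thesis
  proof (intro equalityI subsetI)
    fix B assume "B \<in> control (psl_class (heis a b c))"
    then obtain d \<mu> where B: "det B = 1" and d: "d ^ 3 = 1"
      and eq: "mat d ** transl c = mat \<mu> ** B"
      by (auto simp: control_def psl_class_def r_coset_def scalars_def dm lb)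
    have d0: "d \<noteq> 0" using d by auto
    have "d ^ 2 = \<mu> ^ 2"
      using arg_cong[OF eq, of det] det_t B by (simp add: det_mul dm)
    then have \<mu>0: "\<mu> \<noteq> 0" and "(d / \<mu>) ^ 2 = 1" using d0 by (auto simp: power_divide)
    moreover have "B = mat (d / \<mu>) ** transl c"
    proof -
      have "B = mat (1 / \<mu>) ** (mat \<mu> ** B)"
        using \<mu>0 by (simp add: matrix_mul_assoc mat_mult_mat)
      also have "\<dots> = mat (d / \<mu>) ** transl c"
        by (simp add: eq[symmetric] matrix_mul_assoc mat_mult_mat)
      finally show ?thesis .
    qed
    ultimately show "B \<in> psl_class (transl c)"
      by (auto simp: psl_class_def r_coset_def scalars_def dm intro!: exI[of _ "mat (d / \<mu>)"])
  next
    fix B assume "B \<in> psl_class (transl c)"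
    then obtain e where e: "e ^ 2 = 1" "B = mat e ** transl c"
      by (auto simp: psl_class_def r_coset_def scalars_def dm)
    have "det B = 1" using e det_t by (simp add: det_mul dm)
    moreover have "heis a b c \<in> psl_class (heis a b c)"
      by (auto simp: psl_class_def r_coset_def scalars_def intro!: exI[of _ "mat 1"])
    moreover have "lower_block (heis a b c) = mat e ** B"
      using e by (simp add: lb1 matrix_mul_assoc mat_mult_mat power2_eq_square)
    ultimately show "B \<in> control (psl_class (heis a b c))"
      by (auto simp: control_def)
  qed
qed

text \<open>The line through \<open>[1:0:0]\<close> with parameter \<open>p\<close> in the projective line, as a
  linear subspace of \<open>\<complex>\<^sup>3\<close>.\<close>

definition pencil_line :: "(complex^2) set \<Rightarrow> (complex^3) set" where
  "pencil_line p = {v. vector [v $ 2, v $ 3] \<in> p}"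

lemma control_induced_action:
  assumes g: "g \<in> Heis" and p: "vec.subspace p"
  shows "psl_act g (pencil_line p) = pencil_line (psl_act (control g) p)"
proof -
  from g obtain a b c where g: "g = psl_class (heis a b c)" by (auto simp: Heis_def)
  have sub: "vec.subspace (pencil_line p)"
  proof (rule vec.subspaceI)
    have "vector [0, 0] = (0 :: complex^2)" by (simp add: vec_eq_iff forall_2)
    then show "0 \<in> pencil_line p" using vec.subspace_0[OF p] by (simp add: pencil_line_def)
  next
    fix x y assume xy: "x \<in> pencil_line p" "y \<in> pencil_line p"
    have "vector [(x + y) $ 2, (x + y) $ 3] = (vector [x $ 2, x $ 3] + vector [y $ 2, y $ 3] :: complex^2)"
      by (simp add: vec_eq_iff forall_2)
    then show "x + y \<in> pencil_line p"
      using xy vec.subspace_add[OF p] by (simp add: pencil_line_def)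
  next
    fix d x assume x: "x \<in> pencil_line p"
    have "vector [(d *s x) $ 2, (d *s x) $ 3] = (d *s vector [x $ 2, x $ 3] :: complex^2)"
      by (simp add: vec_eq_iff forall_2)
    then show "d *s x \<in> pencil_line p"
      using x vec.subspace_scale[OF p] by (simp add: pencil_line_def)
  qed
  have h: "heis a b c *v v = vector [v $ 1 + a * v $ 2 + b * v $ 3, v $ 2 + c * v $ 3, v $ 3]" for v
    by (simp add: heis_def matrix_vector_mult_def vec_eq_iff forall_3 sum_3)
  have t: "transl c *v v = vector [v $ 1 + c * v $ 2, v $ 2]" for v
    by (simp add: transl_def matrix_vector_mult_def vec_eq_iff forall_2 sum_2)
  have ht: "vector [(heis a b c *v v) $ 2, (heis a b c *v v) $ 3] = transl c *v vector [v $ 2, v $ 3]" for v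
    by (simp add: h t)
  have "(*v) (heis a b c) ` pencil_line p = pencil_line ((*v) (transl c) ` p)"
  proof (intro equalityI subsetI)
    fix w assume "w \<in> (*v) (heis a b c) ` pencil_line p"
    then show "w \<in> pencil_line ((*v) (transl c) ` p)"
      using ht by (auto simp: pencil_line_def)
  next
    fix w assume "w \<in> pencil_line ((*v) (transl c) ` p)"
    then obtain u where u: "u \<in> p" "vector [w $ 2, w $ 3] = transl c *v u"
      by (auto simp: pencil_line_def)
    define v :: "complex^3" where "v = vector [w $ 1 - a * u $ 1 - b * u $ 2, u $ 1, u $ 2]"
    have "vector [v $ 2, v $ 3] = u" by (simp add: v_def vec_eq_iff forall_2)
    then have "v \<in> pencil_line p" using u by (simp add: pencil_line_def)
    moreover have "w = heis a b c *v v"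
      using u(2) by (simp add: h t v_def vec_eq_iff forall_2 forall_3)
    ultimately show "w \<in> (*v) (heis a b c) ` pencil_line p" by blast
  qed
  then show ?thesis
    by (simp add: g control_heis psl_act_psl_class[OF sub] psl_act_psl_class[OF p])
qed

end

theory Submission
  imports Defs
begin

text \<open>
  An element of \<open>Heis(3,\<complex>)\<close> has exactly one unipotent lift, so \<open>G\<close> is the same thing as a
  discrete group \<open>H\<close> of triples \<open>(a, b, c)\<close> under the law
  \<open>(a, b, c) (a', b', c') = (a + a', b + b' + a c', c + c')\<close>. Every lift of a nontrivial
  element is a cube root of unity times a nontrivial unipotent matrix: it has a single eigenvalue, of
  modulus 1, and is not scalar, hence not diagonalizable. So \<open>G\<close> is purely parabolic.

  The control morphism is \<open>(a, b, c) \<mapsto> c\<close>, with kernel \<open>Ker \<subseteq> \<complex>\<^sup>2\<close> (the \<open>(a, b)\<close>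
  with \<open>(a, b, 0) \<in> H\<close>) and image \<open>Img \<subseteq> \<complex>\<close>. If \<open>Img\<close> is free abelian of rank \<open>m\<close>,
  adjoining its generators one by one gives extensions with infinite cyclic quotient; these split, so
  \<open>G = Ker \<rtimes> \<int> \<rtimes> \<dots> \<rtimes> \<int>\<close> with \<open>m\<close> factors \<open>\<int>\<close>
  (\<open>Z_flag_imp_iterated_semidirect\<close>). In general \<open>Img\<close> is not discrete in \<open>\<complex>\<close>, so its
  freeness and the bounds on \<open>r + m\<close>, where \<open>r\<close> is the rank of \<open>Ker\<close>, need an argument.
  The tool is that a discrete subgroup of a Euclidean space is free of rank at most the dimension of its
  real span (\<open>discrete_subgroup_Z_flag\<close>). In particular \<open>r \<le> 4\<close>. Commutators are central:
  they are \<open>(0, a c' - a' c, 0)\<close>; write \<open>Cen\<close> for the discrete group of all \<open>b\<close> with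
  \<open>(0, b, 0) \<in> H\<close>. There are two cases.

  \<^item> Some \<open>(a, b) \<in> Ker\<close> has \<open>a \<noteq> 0\<close>. Then \<open>a Img \<subseteq> Cen\<close>, so \<open>Img\<close> is
    discrete in \<open>\<complex>\<close> and \<open>m \<le> 2\<close>, whence \<open>r + m \<le> 6\<close>.

  \<^item> \<open>Ker = {0} \<times> Cen\<close>. Let \<open>L\<close> be the real span of \<open>Cen\<close>. The coordinate
    \<open>\<beta> = b - a c / 2\<close> is additive up to half of a commutator, so \<open>(a, c, \<beta> mod L)\<close> is a
    homomorphism on \<open>H\<close>. Its image is discrete because \<open>Cen\<close> is cocompact in \<open>L\<close>, and it is
    isomorphic to \<open>Img\<close>. With \<open>W\<close> the real span of the pairs \<open>(a, c)\<close> this gives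
    \<open>m \<le> dim W + 2 - dim L\<close>, while \<open>r \<le> dim L\<close>; so \<open>r + m \<le> dim W + 2 \<le> 6\<close>. If
    \<open>L \<noteq> \<complex>\<close>, a real functional vanishing on \<open>L\<close> turns \<open>a c' - a' c\<close> into a
    nondegenerate symplectic form on \<open>\<complex>\<^sup>2 = \<real>\<^sup>4\<close> for which \<open>W\<close> is isotropic; so
    \<open>dim W \<le> 2\<close> and even \<open>r + m \<le> 4\<close>.

  Let \<open>G\<close> be complex Kleinian. In the affine chart \<open>[x : y : 1]\<close> the group acts on an open set
  properly discontinuously by \<open>(x, y) \<mapsto> (x + a y + b, y + c)\<close>. The kernel translates the line over a
  point \<open>y\<close> by \<open>a y + b\<close>, so these numbers form a discrete subgroup of \<open>\<complex>\<close> isomorphic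
  to \<open>Ker\<close>, and \<open>r \<le> 2\<close> (\<open>Ker_flag_proper\<close>). It remains to see \<open>m \<le> 2\<close> when
  \<open>Ker = {0} \<times> Cen\<close> and \<open>L = \<complex>\<close>. If \<open>Img\<close> were not discrete, there would be elements
  with \<open>c\<close> tending to 0 and \<open>a\<close> to infinity, and moving \<open>y\<close> slightly changes \<open>a y + b\<close> by
  enough to make it an element of the cocompact group \<open>Cen\<close>; correcting by that central element leaves
  infinitely many elements that hardly move a point (\<open>Img_discrete_proper\<close>).\<close>

section \<open>Discrete subgroups of real vector spaces\<close>

definition add_subgroup :: "'a::real_vector set \<Rightarrow> bool" where
  "add_subgroup A \<longleftrightarrow> 0 \<in> A \<and> (\<forall>x\<in>A. \<forall>y\<in>A. x - y \<in> A)"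

definition discrete_at_0 :: "'a::real_normed_vector set \<Rightarrow> bool" where
  "discrete_at_0 A \<longleftrightarrow> (\<exists>e>0. \<forall>x\<in>A. norm x < e \<longrightarrow> x = 0)"

text \<open>\<open>Z_flag A k\<close> says that \<open>A\<close> arises from \<open>0\<close> by \<open>k\<close> successive extensions by an infinite
  cyclic group, that is, that \<open>A\<close> has a \<open>\<int>\<close>-basis of \<open>k\<close> elements. A flag is the form in
  which the basis is used: each step becomes one semidirect factor.\<close>

inductive Z_flag :: "'a::real_vector set \<Rightarrow> nat \<Rightarrow> bool" where
  zero: "Z_flag {0} 0"
| step: "Z_flag A k \<Longrightarrow> (\<And>n::int. of_int n *\<^sub>R u \<in> A \<Longrightarrow> n = 0) \<Longrightarrow>
         Z_flag {a + of_int n *\<^sub>R u |a n. a \<in> A} (Suc k)"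

lemma add_subgroup_minus: "add_subgroup A \<Longrightarrow> x \<in> A \<Longrightarrow> - x \<in> A"
  unfolding add_subgroup_def by (metis diff_0)

lemma add_subgroup_diff: "add_subgroup A \<Longrightarrow> x \<in> A \<Longrightarrow> y \<in> A \<Longrightarrow> x - y \<in> A"
  unfolding add_subgroup_def by blast

lemma add_subgroup_add: "add_subgroup A \<Longrightarrow> x \<in> A \<Longrightarrow> y \<in> A \<Longrightarrow> x + y \<in> A"
  using add_subgroup_minus add_subgroup_diff by (metis diff_minus_eq_add)

lemma add_subgroup_of_nat: "add_subgroup A \<Longrightarrow> x \<in> A \<Longrightarrow> of_nat n *\<^sub>R x \<in> A"
  by (induction n) (auto simp: add_subgroup_def scaleR_add_left intro: add_subgroup_add[unfolded add_subgroup_def])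

lemma add_subgroup_of_int:
  assumes "add_subgroup A" "x \<in> A"
  shows "of_int n *\<^sub>R x \<in> A"
proof (cases n)
  case (nonneg m)
  then show ?thesis using add_subgroup_of_nat[OF assms, of m] by simp
next
  case (neg m)
  then show ?thesis
    using add_subgroup_minus[OF assms(1) add_subgroup_of_nat[OF assms, of "Suc m"]]
    by (simp only: of_int_minus of_int_of_nat_eq scaleR_minus_left)
qed

lemma add_subgroup_sum:
  "add_subgroup A \<Longrightarrow> (\<And>i. i \<in> I \<Longrightarrow> f i \<in> A) \<Longrightarrow> sum f I \<in> A"
  by (induction I rule: infinite_finite_induct) (auto intro: add_subgroup_add simp: add_subgroup_def)

lemma Z_flag_add_subgroup: "Z_flag A k \<Longrightarrow> add_subgroup A"
proof (induction rule: Z_flag.induct)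
  case zero
  then show ?case by (simp add: add_subgroup_def)
next
  case (step A k u)
  have "\<exists>a n. x - y = a + of_int n *\<^sub>R u \<and> a \<in> A"
    if "x = b + of_int m *\<^sub>R u" "b \<in> A" "y = c + of_int l *\<^sub>R u" "c \<in> A" for x y b m c l
    using that add_subgroup_diff[OF step.IH, of b c]
    by (intro exI[of _ "b - c"] exI[of _ "m - l"]) (simp add: algebra_simps)
  moreover have "\<exists>a n. 0 = a + of_int n *\<^sub>R u \<and> a \<in> A"
    using step.IH by (intro exI[of _ 0]) (simp add: add_subgroup_def)
  ultimately show ?case
    unfolding add_subgroup_def by blast
qed

lemma additive_on_subgroup:
  fixes f :: "'a::real_vector \<Rightarrow> 'b::real_vector"
  assumes A: "add_subgroup A" and f: "\<And>x y. x \<in> A \<Longrightarrow> y \<in> A \<Longrightarrow> f (x + y) = f x + f y"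
  shows "f 0 = 0" and "x \<in> A \<Longrightarrow> f (- x) = - f x" and "x \<in> A \<Longrightarrow> f (of_int n *\<^sub>R x) = of_int n *\<^sub>R f x"
proof -
  have A0: "0 \<in> A" using A by (simp add: add_subgroup_def)
  show f0: "f 0 = 0" using f[OF A0 A0] by simp
  have neg: "f (- x) = - f x" if "x \<in> A" for x
    using f[OF that add_subgroup_minus[OF A that]] f0 by (simp add: eq_neg_iff_add_eq_0 add.commute)
  then show "x \<in> A \<Longrightarrow> f (- x) = - f x" .
  assume x: "x \<in> A"
  have nat: "f (of_nat k *\<^sub>R x) = of_nat k *\<^sub>R f x" for k
  proof (induction k)
    case (Suc k)
    have "f (x + of_nat k *\<^sub>R x) = f x + f (of_nat k *\<^sub>R x)"
      using f[OF x add_subgroup_of_nat[OF A x]] .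
    with Suc show ?case by (simp add: scaleR_add_left)
  qed (simp add: f0)
  show "f (of_int n *\<^sub>R x) = of_int n *\<^sub>R f x"
  proof (cases n)
    case (nonneg k)
    then show ?thesis using nat[of k] by simp
  next
    case (neg k)
    have "f (- (of_nat (Suc k) *\<^sub>R x)) = - (of_nat (Suc k) *\<^sub>R f x)"
      using \<open>\<And>x. x \<in> A \<Longrightarrow> f (- x) = - f x\<close>[OF add_subgroup_of_nat[OF A x]] nat by metis
    then show ?thesis by (simp only: neg of_int_minus of_int_of_nat_eq scaleR_minus_left)
  qed
qed

text \<open>The map is only assumed additive and injective on \<open>A\<close>: ranks are carried along the inverse of a linear
  map that is injective on a subgroup but not on its span, and such an inverse does not extend linearly.\<close>

lemma Z_flag_image:
  fixes f :: "'a::real_vector \<Rightarrow> 'b::real_vector"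
  assumes "Z_flag A k" and "\<And>x y. x \<in> A \<Longrightarrow> y \<in> A \<Longrightarrow> f (x + y) = f x + f y"
    and "\<And>x. x \<in> A \<Longrightarrow> f x = 0 \<Longrightarrow> x = 0"
  shows "Z_flag (f ` A) k"
  using assms
proof (induction rule: Z_flag.induct)
  case zero
  have "f 0 = 0" using zero(1)[of 0 0] by simp
  then show ?case using Z_flag.zero by simp
next
  case (step A k u)
  let ?A' = "{a + of_int n *\<^sub>R u |a n. a \<in> A}"
  have A: "add_subgroup A" using step.hyps(1) by (rule Z_flag_add_subgroup)
  have A': "add_subgroup ?A'" using Z_flag.step[OF step.hyps] by (rule Z_flag_add_subgroup)
  have AA': "x \<in> ?A'" if "x \<in> A" for x
  proof -
    have "x = x + of_int 0 *\<^sub>R u" by simp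
    with that show ?thesis by blast
  qed
  have "u = 0 + of_int 1 *\<^sub>R u" by simp
  then have u: "u \<in> ?A'" using A unfolding add_subgroup_def by blast
  note f = additive_on_subgroup[OF A' step.prems(1)]
  have fu: "f (a + of_int n *\<^sub>R u) = f a + of_int n *\<^sub>R f u" if "a \<in> A" for a n
    using step.prems(1)[OF AA'[OF that] add_subgroup_of_int[OF A' u]] f(3)[OF _ _ u] by simp
  have "Z_flag (f ` A) k"
  proof (rule step.IH)
    show "f (x + y) = f x + f y" if "x \<in> A" "y \<in> A" for x y
      using step.prems(1)[OF AA'[OF that(1)] AA'[OF that(2)]] .
    show "x = 0" if "x \<in> A" "f x = 0" for x
      using step.prems(2)[OF AA'[OF that(1)] that(2)] .
  qed
  moreover have "n = 0" if n: "of_int n *\<^sub>R f u \<in> f ` A" for n :: int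
  proof -
    from n obtain a where a: "a \<in> A" "of_int n *\<^sub>R f u = f a" by blast
    have "f (- a + of_int n *\<^sub>R u) = 0"
      using fu[OF add_subgroup_minus[OF A a(1)]] f(2)[OF _ _ AA'[OF a(1)]] a(2) by simp
    moreover have "- a + of_int n *\<^sub>R u \<in> ?A'"
      using add_subgroup_minus[OF A a(1)] by blast
    ultimately have "- a + of_int n *\<^sub>R u = 0" using step.prems(2) by blast
    then show "n = 0" using step.hyps(2) a(1) by simp
  qed
  ultimately have "Z_flag {a + of_int n *\<^sub>R f u |a n. a \<in> f ` A} (Suc k)"
    by (rule Z_flag.step)
  moreover have "{a + of_int n *\<^sub>R f u |a n. a \<in> f ` A} = f ` ?A'"
  proof
    show "{a + of_int n *\<^sub>R f u |a n. a \<in> f ` A} \<subseteq> f ` ?A'"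
    proof clarify
      fix a n assume a: "a \<in> A"
      then have "a + of_int n *\<^sub>R u \<in> ?A'" by blast
      then have "f (a + of_int n *\<^sub>R u) \<in> f ` ?A'" by (rule imageI)
      then show "f a + of_int n *\<^sub>R f u \<in> f ` ?A'" by (simp only: fu[OF a])
    qed
    show "f ` ?A' \<subseteq> {a + of_int n *\<^sub>R f u |a n. a \<in> f ` A}"
    proof clarify
      fix a n assume a: "a \<in> A"
      show "\<exists>b m. f (a + of_int n *\<^sub>R u) = b + of_int m *\<^sub>R f u \<and> b \<in> f ` A"
        using fu[OF a] imageI[OF a, of f] by (intro exI conjI)
    qed
  qed
  ultimately show ?case by (simp only:)
qed

text \<open>The generators occur in the form of a test set for subgroups, which needs no notion of
  generated additive subgroup.\<close>

lemma Z_flag_generators: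
  assumes "Z_flag A k"
  shows "\<exists>S. finite S \<and> card S \<le> k \<and> S \<subseteq> A \<and> (\<forall>C. add_subgroup C \<longrightarrow> S \<subseteq> C \<longrightarrow> A \<subseteq> C)"
  using assms
proof (induction rule: Z_flag.induct)
  case zero
  show ?case by (rule exI[of _ "{}"]) (simp add: add_subgroup_def)
next
  case (step A k u)
  then obtain S where S: "finite S" "card S \<le> k" "S \<subseteq> A" 
    "\<And>C. add_subgroup C \<Longrightarrow> S \<subseteq> C \<Longrightarrow> A \<subseteq> C" by blast
  have A0: "0 \<in> A" using Z_flag_add_subgroup[OF step.hyps(1)] by (simp add: add_subgroup_def)
  show ?case
  proof (intro exI conjI allI impI)
    show "finite (insert u S)" using S(1) by simp
    show "card (insert u S) \<le> Suc k" using S(1,2) by (simp add: card_insert_if)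
    have "u = 0 + of_int 1 *\<^sub>R u" by simp
    then have "u \<in> {a + of_int n *\<^sub>R u |a n. a \<in> A}" using A0 by blast
    moreover have "x \<in> {a + of_int n *\<^sub>R u |a n. a \<in> A}" if "x \<in> A" for x
    proof -
      have "x = x + of_int 0 *\<^sub>R u" by simp
      with that show ?thesis by blast
    qed
    ultimately show "insert u S \<subseteq> {a + of_int n *\<^sub>R u |a n. a \<in> A}" using S(3) by blast
    fix C assume C: "add_subgroup C" "insert u S \<subseteq> C"
    with S(4)[OF C(1)] show "{a + of_int n *\<^sub>R u |a n. a \<in> A} \<subseteq> C"
      by (auto intro!: add_subgroup_add add_subgroup_of_int)
  qed
qed

text \<open>Differences of elements of \<open>A\<close> lie in \<open>A\<close>, so isolation of \<open>0\<close> is uniform, and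
  bounded closed sets are compact.\<close>

lemma discrete_at_0_ball_finite:
  fixes A :: "'a::euclidean_space set"
  assumes "add_subgroup A" "discrete_at_0 A"
  shows "finite {x \<in> A. norm x \<le> R}"
proof -
  obtain e where e: "e > 0" "\<And>x. x \<in> A \<Longrightarrow> norm x < e \<Longrightarrow> x = 0"
    using assms(2) by (auto simp: discrete_at_0_def)
  have "uniform_discrete A"
    unfolding uniform_discrete_def dist_norm
    using e add_subgroup_diff[OF assms(1)] by (metis eq_iff_diff_eq_0)
  then have "uniform_discrete {x \<in> A. norm x \<le> R}" by (rule uniform_discrete_subset) auto
  moreover have "bounded {x \<in> A. norm x \<le> R}" by (rule boundedI[of _ R]) auto
  ultimately show ?thesis using uniform_discrete_finite_iff by blast
qed

lemma finite_ball_imp_discrete_at_0: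
  fixes A :: "'a::real_normed_vector set"
  assumes "finite {x \<in> A. norm x < e}" "e > 0"
  shows "discrete_at_0 A"
proof -
  let ?F = "{x \<in> A. norm x < e} - {0}"
  define d where "d = Min (insert e (norm ` ?F))"
  have "finite (insert e (norm ` ?F))" using assms by simp
  then have "d > 0" and d: "d \<le> e" "\<And>x. x \<in> ?F \<Longrightarrow> d \<le> norm x"
    using assms(2) unfolding d_def by (auto simp: Min_gr_iff)
  have "x = 0" if "x \<in> A" "norm x < d" for x
    using that d by (metis (no_types, lifting) DiffI less_le_trans mem_Collect_eq not_le singletonD)
  with \<open>d > 0\<close> show ?thesis unfolding discrete_at_0_def by blast
qed

text \<open>A subgroup is cocompact in its real span: round down the coordinates in a basis taken from the
  subgroup.\<close>

lemma add_subgroup_cobounded: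
  fixes A :: "'a::euclidean_space set"
  assumes A: "add_subgroup A"
  shows "\<exists>M\<ge>0. \<forall>v\<in>span A. \<exists>x\<in>A. norm (v - x) \<le> M"
proof -
  obtain B where B: "B \<subseteq> A" "independent B" "A \<subseteq> span B"
    using maximal_independent_subset by blast
  have fin: "finite B" using B(2) by (rule independent_imp_finite)
  have "\<exists>x\<in>A. norm (v - x) \<le> (\<Sum>b\<in>B. norm b)" if "v \<in> span A" for v
  proof -
    have "v \<in> span B" using that B(3) by (metis span_mono span_span subsetD)
    then obtain r where r: "v = (\<Sum>b\<in>B. r b *\<^sub>R b)" using fin by (auto simp: span_finite)
    have "(\<Sum>b\<in>B. of_int \<lfloor>r b\<rfloor> *\<^sub>R b) \<in> A"
      using A B(1) by (intro add_subgroup_sum add_subgroup_of_int) auto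
    moreover have "norm (v - (\<Sum>b\<in>B. of_int \<lfloor>r b\<rfloor> *\<^sub>R b)) \<le> (\<Sum>b\<in>B. norm b)"
    proof -
      have "v - (\<Sum>b\<in>B. of_int \<lfloor>r b\<rfloor> *\<^sub>R b) = (\<Sum>b\<in>B. frac (r b) *\<^sub>R b)"
        by (simp add: r frac_def scaleR_diff_left sum_subtractf)
      also have "norm \<dots> \<le> (\<Sum>b\<in>B. norm (frac (r b) *\<^sub>R b))" by (rule norm_sum)
      also have "\<dots> \<le> (\<Sum>b\<in>B. norm b)"
      proof (rule sum_mono)
        fix b
        have "\<bar>frac (r b)\<bar> \<le> 1" using frac_ge_0[of "r b"] frac_lt_1[of "r b"] by linarith
        then show "norm (frac (r b) *\<^sub>R b) \<le> norm b" by (simp add: mult_left_le_one_le)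
      qed
      finally show ?thesis .
    qed
    ultimately show ?thesis by blast
  qed
  then show ?thesis by (intro exI[of _ "\<Sum>b\<in>B. norm b"]) (auto intro: sum_nonneg)
qed

text \<open>Induction on the dimension. Split off one vector \<open>v\<close> of a basis contained in \<open>A\<close>; the elements
  without \<open>v\<close>-coordinate are covered by induction. The values of the \<open>v\<close>-coordinate on \<open>A\<close> form a
  discrete subgroup of \<open>\<real>\<close>, generated by its least positive element, and any \<open>u \<in> A\<close> with
  that coordinate is the last basis vector.\<close>

lemma discrete_subgroup_Z_flag:
  fixes A :: "'a::euclidean_space set"
  assumes "add_subgroup A" "discrete_at_0 A"
  shows "\<exists>k\<le>dim A. Z_flag A k"
  using assms
proof (induction "dim A" arbitrary: A)
  case 0
  then have "A = {0}" by (auto simp: dim_eq_0 add_subgroup_def)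
  then show ?case using Z_flag.zero by force
next
  case (Suc n A)
  obtain B where B: "B \<subseteq> A" "independent B" "A \<subseteq> span B" "card B = dim A"
    using basis_exists by blast
  have finB: "finite B" using B(2) by (rule independent_imp_finite)
  with B(4) Suc(2) obtain v where v: "v \<in> B" by (metis card.empty equals0I nat.distinct(1))
  define A' where "A' = A \<inter> span (B - {v})"
  have subg': "add_subgroup A'"
    using Suc.prems(1) by (auto simp: A'_def add_subgroup_def intro: span_zero span_diff)
  have span': "span A' = span (B - {v})"
  proof
    show "span A' \<subseteq> span (B - {v})" unfolding A'_def by (metis Int_lower2 span_mono span_span)
    show "span (B - {v}) \<subseteq> span A'"
      using B(1) by (intro span_mono) (auto simp: A'_def intro: span_base)
  qed
  have "dim A' = card (B - {v})"
    using span' B(2) by (metis Diff_subset dim_eq_card independent_mono)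
  then have dim': "n = dim A'" using v finB B(4) Suc(2) by simp
  have disc': "discrete_at_0 A'"
    using Suc.prems(2) by (auto simp: A'_def discrete_at_0_def)
  obtain k where k: "k \<le> n" "Z_flag A' k"
    using Suc.hyps(1)[OF dim' subg' disc'] dim' by blast
  obtain g :: "'a \<Rightarrow> real" where g: "linear g" "\<And>x. x \<in> B \<Longrightarrow> g x = (if x = v then 1 else 0)"
    using linear_independent_extend[OF B(2), of "\<lambda>x. if x = v then 1 else 0"] by blast
  have g0: "g x = 0" if "x \<in> span (B - {v})" for x
    by (rule linear_eq_0_on_span[OF g(1) _ that]) (simp add: g(2))
  have dec: "x - g x *\<^sub>R v \<in> span (B - {v})" if "x \<in> A" for x
  proof -
    have "x \<in> span (insert v (B - {v}))" using that B(3) v by (auto simp: insert_absorb)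
    then obtain c where c: "x - c *\<^sub>R v \<in> span (B - {v})" by (metis span_breakdown_eq)
    then have "g (x - c *\<^sub>R v) = 0" by (rule g0)
    then have "g x = c" using g v by (simp add: linear_diff linear_scale)
    with c show ?thesis by simp
  qed
  obtain M where M: "M \<ge> 0" "\<And>w. w \<in> span A' \<Longrightarrow> \<exists>x\<in>A'. norm (w - x) \<le> M"
    using add_subgroup_cobounded[OF subg'] by blast
  \<comment> \<open>Modulo \<open>A'\<close> every element of \<open>A\<close> is bounded in terms of its \<open>v\<close>-coordinate, so only
    finitely many values of that coordinate lie in a bounded interval.\<close>
  have "g ` {x\<in>A. \<bar>g x\<bar> \<le> 1} \<subseteq> g ` {x\<in>A. norm x \<le> norm v + M}"
  proof
    fix t assume "t \<in> g ` {x\<in>A. \<bar>g x\<bar> \<le> 1}"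
    then obtain x where x: "x \<in> A" "\<bar>g x\<bar> \<le> 1" "t = g x" by blast
    obtain y where y: "y \<in> A'" "norm (x - g x *\<^sub>R v - y) \<le> M"
      using M(2) dec[OF x(1)] span' by blast
    have "x - y \<in> A" using Suc.prems(1) x(1) y(1) by (auto simp: A'_def add_subgroup_diff)
    moreover have "g (x - y) = t"
      using x(3) y(1) g0[of y] g(1) by (simp add: A'_def linear_diff)
    moreover have "norm (x - y) \<le> norm v + M"
    proof -
      have "norm (x - y) \<le> norm (g x *\<^sub>R v) + norm (x - g x *\<^sub>R v - y)"
        using norm_triangle_ineq[of "g x *\<^sub>R v" "x - g x *\<^sub>R v - y"] by simp
      also have "norm (g x *\<^sub>R v) \<le> norm v" using x(2) by (simp add: mult_left_le_one_le)
      finally show ?thesis using y(2) by linarith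
    qed
    ultimately show "t \<in> g ` {x\<in>A. norm x \<le> norm v + M}" by force
  qed
  then have "finite (g ` {x\<in>A. \<bar>g x\<bar> \<le> 1})"
    by (rule finite_subset) (intro finite_imageI discrete_at_0_ball_finite Suc.prems)
  then have fin: "finite {t \<in> g ` {x\<in>A. \<bar>g x\<bar> \<le> 1}. t > 0}" (is "finite ?T")
    by (rule finite_subset[rotated]) blast
  have "1 \<in> ?T" using v B(1) g(2)[of v] by (force simp: image_iff)
  define t where "t = Min ?T"
  have tT: "t \<in> ?T" unfolding t_def using fin \<open>1 \<in> ?T\<close> by (intro Min_in) auto
  have tmin: "t \<le> s" if "s \<in> ?T" for s unfolding t_def using fin that by (rule Min_le)
  obtain u where u: "u \<in> A" "g u = t" using tT by blast
  have t0: "t > 0" "t \<le> 1" using tT tmin[OF \<open>1 \<in> ?T\<close>] by auto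
  have mem: "x - of_int \<lfloor>g x / t\<rfloor> *\<^sub>R u \<in> A'" if x: "x \<in> A" for x
  proof -
    let ?y = "x - of_int \<lfloor>g x / t\<rfloor> *\<^sub>R u"
    have y: "?y \<in> A"
      using x u(1) Suc.prems(1) by (intro add_subgroup_diff add_subgroup_of_int)
    have "g ?y = g x - of_int \<lfloor>g x / t\<rfloor> * t"
      using g(1) u(2) by (simp add: linear_diff linear_scale)
    also have "\<dots> = frac (g x / t) * t" using t0(1) by (simp add: frac_def field_simps)
    finally have gy: "g ?y = frac (g x / t) * t" .
    have "frac (g x / t) * t < t" using t0(1) frac_lt_1[of "g x / t"] by simp
    moreover have "0 \<le> frac (g x / t) * t" using t0(1) by simp
    ultimately have bounds: "g ?y < t" "0 \<le> g ?y" using gy by simp_all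
    have "g ?y = 0"
    proof (rule ccontr)
      assume "g ?y \<noteq> 0"
      then have "g ?y \<in> ?T" using bounds y t0(2) by simp
      then show False using tmin bounds(1) by fastforce
    qed
    then show ?thesis using dec[OF y] y by (simp add: A'_def)
  qed
  have "Z_flag {a + of_int m *\<^sub>R u |a m. a \<in> A'} (Suc k)"
  proof (rule Z_flag.step[OF k(2)])
    fix m :: int assume "of_int m *\<^sub>R u \<in> A'"
    then have "g (of_int m *\<^sub>R u) = 0" by (simp add: A'_def g0)
    then show "m = 0" using g(1) u(2) t0(1) by (simp add: linear_scale)
  qed
  moreover have "{a + of_int m *\<^sub>R u |a m. a \<in> A'} = A"
  proof
    show "{a + of_int m *\<^sub>R u |a m. a \<in> A'} \<subseteq> A"
      using u(1) Suc.prems(1) by (auto simp: A'_def intro!: add_subgroup_add add_subgroup_of_int)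
    show "A \<subseteq> {a + of_int m *\<^sub>R u |a m. a \<in> A'}"
    proof
      fix x assume "x \<in> A"
      then show "x \<in> {a + of_int m *\<^sub>R u |a m. a \<in> A'}"
        using mem[of x] by (metis (mono_tags, lifting) diff_add_cancel mem_Collect_eq)
    qed
  qed
  ultimately have "Z_flag A (Suc k)" by (simp only:)
  then show ?case using k(1) Suc(2) by (metis Suc_le_mono)
qed

text \<open>Extend a basis of \<open>L\<close> to the whole space and kill the basis vectors in \<open>L\<close>. Such a projection
  realizes the quotient by \<open>L\<close> inside the space itself.\<close>

lemma exists_projection_along:
  fixes L :: "'a::euclidean_space set"
  assumes "subspace L"
  shows "\<exists>\<pi>::'a \<Rightarrow> 'a. linear \<pi> \<and> (\<forall>x. x - \<pi> x \<in> L) \<and> (\<forall>x\<in>L. \<pi> x = 0) \<and>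
    dim (range \<pi>) + dim L \<le> DIM('a)"
proof -
  obtain B where B: "B \<subseteq> L" "independent B" "L \<subseteq> span B"
    using maximal_independent_subset by blast
  have LB: "span B = L" using B(1,3) assms by (metis span_minimal subset_antisym)
  obtain C where C: "B \<subseteq> C" "independent C" "UNIV \<subseteq> span C"
    by (rule maximal_independent_subset_extend[OF subset_UNIV B(2)])
  have fin: "finite C" using C(2) by (rule independent_imp_finite)
  obtain \<pi> :: "'a \<Rightarrow> 'a" where \<pi>: "linear \<pi>" "\<And>x. x \<in> C \<Longrightarrow> \<pi> x = (if x \<in> B then 0 else x)"
    using linear_independent_extend[OF C(2), of "\<lambda>x. if x \<in> B then 0 else x"] by blast
  have "x - \<pi> x \<in> L" for x
  proof -
    have "x \<in> span C" using C(3) by blast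
    then show ?thesis
    proof (induction rule: span_induct_alt)
      case base
      then show ?case using \<pi>(1) assms by (simp add: linear_0 subspace_0)
    next
      case (step c b y)
      have "b - \<pi> b \<in> L" using \<pi>(2)[OF step(1)] B(1) assms by (auto simp: subspace_0)
      then have "c *\<^sub>R (b - \<pi> b) + (y - \<pi> y) \<in> L"
        using step(2) assms by (intro subspace_add subspace_scale)
      then show ?case using \<pi>(1) by (simp add: linear_add linear_scale algebra_simps)
    qed
  qed
  moreover have "\<pi> x = 0" if "x \<in> L" for x
  proof (rule linear_eq_0_on_span[OF \<pi>(1)])
    show "x \<in> span B" using that LB by simp
    show "\<pi> y = 0" if "y \<in> B" for y using \<pi>(2)[of y] that C(1) by auto
  qed
  moreover have "dim (range \<pi>) + dim L \<le> DIM('a)"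
  proof -
    have spanC: "span C = UNIV" using C(3) by blast
    have "range \<pi> = span (\<pi> ` C)" by (simp only: linear_span_image[OF \<pi>(1)] spanC)
    also have "\<dots> \<subseteq> span (C - B)"
    proof (rule span_minimal)
      show "\<pi> ` C \<subseteq> span (C - B)"
      proof clarify
        fix x assume x: "x \<in> C"
        show "\<pi> x \<in> span (C - B)"
          using x by (cases "x \<in> B") (simp_all add: \<pi>(2)[OF x] span_zero span_base)
      qed
    qed simp
    finally have "dim (range \<pi>) \<le> dim (span (C - B))" by (rule dim_subset)
    also have "\<dots> \<le> card (C - B)" using fin by (simp add: dim_le_card')
    finally have "dim (range \<pi>) + card B \<le> card C"
      using fin C(1) by (metis Nat.le_diff_conv2 card_Diff_subset card_mono finite_subset)
    moreover have "dim L = card B" using LB B(2) dim_eq_card_independent dim_span by metis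
    moreover have "card C = DIM('a)"
      using C(2) spanC dim_eq_card_independent dim_span dim_UNIV by metis
    ultimately show ?thesis by simp
  qed
  ultimately show ?thesis using \<pi>(1) by blast
qed

text \<open>\<open>Re (cnj u (a c' - a' c))\<close> is a nondegenerate symplectic form on \<open>\<real>\<^sup>4\<close>: it equals the inner product of
  \<open>(a, c)\<close> with \<open>J (a', c')\<close> for an injective linear \<open>J\<close>. If \<open>V\<close> is isotropic, \<open>V\<close>
  and \<open>J V\<close> are orthogonal and have the same dimension.\<close>

lemma complex_isotropic_dim_le:
  fixes V :: "(complex \<times> complex) set"
  assumes u: "u \<noteq> 0"
    and iso: "\<And>a c a' c'. (a, c) \<in> V \<Longrightarrow> (a', c') \<in> V \<Longrightarrow> inner u (a * c' - a' * c) = 0"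
  shows "dim V \<le> 2"
proof -
  define J :: "complex \<times> complex \<Rightarrow> complex \<times> complex" where
    "J v = (u * cnj (snd v), - u * cnj (fst v))" for v
  have J: "linear J"
    by (rule linearI) (auto simp: J_def algebra_simps scaleR_conv_of_real)
  have inj: "inj J"
    using u by (auto simp: inj_def J_def prod_eq_iff)
  have JV: "inner v (J w) = 0" if "v \<in> V" "w \<in> V" for v w
  proof -
    have "inner v (J w) = inner u (fst v * snd w - fst w * snd v)"
      by (simp add: J_def inner_prod_def inner_complex_def algebra_simps)
    then show ?thesis using iso[of "fst v" "snd v" "fst w" "snd w"] that by simp
  qed
  have orth: "J ` V \<subseteq> {y \<in> UNIV. \<forall>x\<in>span V. orthogonal x y}"
  proof
    fix y assume "y \<in> J ` V"
    then have "\<And>x. x \<in> V \<Longrightarrow> orthogonal y x" using JV by (auto simp: orthogonal_def inner_commute)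
    then show "y \<in> {y \<in> UNIV. \<forall>x\<in>span V. orthogonal x y}"
      using orthogonal_to_span[of _ V y] by (auto simp: orthogonal_commute)
  qed
  have "dim V = dim (J ` V)" using dim_image_eq[OF J] inj by (metis inj_on_subset subset_UNIV)
  also have "\<dots> \<le> dim {y \<in> UNIV. \<forall>x\<in>span V. orthogonal x y}" by (rule dim_subset[OF orth])
  finally have "dim V + dim (span V) \<le> 4"
    using dim_subspace_orthogonal_to_vectors[of "span V" "UNIV :: (complex \<times> complex) set"] by simp
  then show ?thesis by simp
qed

section \<open>Iterated semidirect products with infinite cyclic factors\<close>

lemma iterated_semidirect_cong:
  assumes "\<And>i. i \<in> {1..n} \<Longrightarrow> B i = C i"
  shows "iterated_semidirect Gr N B n H \<longleftrightarrow> iterated_semidirect Gr N C n H"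
  using assms
proof (induction n arbitrary: H)
  case (Suc n)
  then have "iterated_semidirect Gr N B n M = iterated_semidirect Gr N C n M" for M by simp
  moreover have "B (Suc n) = C (Suc n)" using Suc.prems by simp
  ultimately show ?case by simp
qed simp

context group
begin

lemma iso_Z_power_1:
  assumes u: "u \<in> carrier G" and inj: "\<And>n::int. u [^] n = \<one> \<Longrightarrow> n = 0"
  shows "G\<lparr>carrier := range (\<lambda>n::int. u [^] n)\<rparr> \<cong> Z_power 1"
proof -
  have "(\<lambda>f. u [^] (f 0 :: int)) \<in> iso (Z_power 1) (G\<lparr>carrier := range (\<lambda>n::int. u [^] n)\<rparr>)"
    unfolding iso_def bij_betw_def
  proof (intro CollectI conjI)
    show "(\<lambda>f. u [^] (f 0 :: int)) \<in> hom (Z_power 1) (G\<lparr>carrier := range (\<lambda>n::int. u [^] n)\<rparr>)"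
      using u by (auto simp: hom_def Z_power_def int_pow_mult)
    show "inj_on (\<lambda>f. u [^] (f 0 :: int)) (carrier (Z_power 1))"
    proof (rule inj_onI)
      fix f g :: "nat \<Rightarrow> int"
      assume fg: "f \<in> carrier (Z_power 1)" "g \<in> carrier (Z_power 1)"
        and "u [^] f 0 = u [^] g 0"
      then have "u [^] (f 0 - g 0) = \<one>" using u by (simp add: int_pow_diff)
      then have "f 0 = g 0" using inj by force
      with fg show "f = g" by (auto simp: Z_power_def intro!: PiE_ext[of f "{..<1}" "\<lambda>_. UNIV" g])
    qed
    have "u [^] n \<in> (\<lambda>f. u [^] (f 0 :: int)) ` carrier (Z_power 1)" for n :: int
      by (rule image_eqI[of _ _ "\<lambda>i\<in>{..<1}. n"]) (auto simp: Z_power_def)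
    then show "(\<lambda>f. u [^] (f 0 :: int)) ` carrier (Z_power 1)
        = carrier (G\<lparr>carrier := range (\<lambda>n::int. u [^] n)\<rparr>)"
      by auto
  qed
  moreover have "Group.group (Z_power 1)" by (simp add: Z_power_def)
  ultimately show ?thesis using group.iso_set_sym unfolding is_iso_def by blast
qed

lemma subgroup_int_powers:
  assumes u: "u \<in> carrier G"
  shows "subgroup (range (\<lambda>n::int. u [^] n)) G"
proof
  show "range (\<lambda>n::int. u [^] n) \<subseteq> carrier G" using u by auto
  show "\<one> \<in> range (\<lambda>n::int. u [^] n)" by (rule range_eqI[of _ _ 0]) simp
next
  fix x y assume "x \<in> range (\<lambda>n::int. u [^] n)" "y \<in> range (\<lambda>n::int. u [^] n)"
  then obtain m n :: int where "x = u [^] m" "y = u [^] n" by blast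
  then show "x \<otimes> y \<in> range (\<lambda>n::int. u [^] n)"
    using u by (intro range_eqI[of _ _ "m + n"]) (simp add: int_pow_mult)
next
  fix x assume "x \<in> range (\<lambda>n::int. u [^] n)"
  then obtain m :: int where "x = u [^] m" by blast
  then show "inv x \<in> range (\<lambda>n::int. u [^] n)"
    using u by (intro range_eqI[of _ _ "- m"]) (simp add: int_pow_neg)
qed

text \<open>One step of the flag enlarges the group of values from \<open>A\<close> to \<open>A + \<int>t\<close>. The preimage of \<open>A\<close>
  is normal in that of \<open>A + \<int>t\<close>, and the powers of any \<open>u\<close> with value \<open>t\<close> form a
  complement, because the multiples of \<open>t\<close> meet \<open>A\<close> only in \<open>0\<close>.\<close>

lemma Z_flag_imp_iterated_semidirect:
  fixes \<phi> :: "'a \<Rightarrow> 'v::real_vector"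
  assumes H: "subgroup H G"
    and \<phi>: "\<And>x y. x \<in> H \<Longrightarrow> y \<in> H \<Longrightarrow> \<phi> (x \<otimes> y) = \<phi> x + \<phi> y"
    and "Z_flag A k" "A \<subseteq> \<phi> ` H"
  shows "\<exists>B. iterated_semidirect G {x \<in> H. \<phi> x = 0} B k {x \<in> H. \<phi> x \<in> A} \<and>
    (\<forall>i\<in>{1..k}. subgroup (B i) (G\<lparr>carrier := H\<rparr>) \<and> G\<lparr>carrier := B i\<rparr> \<cong> Z_power 1)"
  using assms(3,4)
proof (induction rule: Z_flag.induct)
  case zero
  then show ?case by simp
next
  case (step A k t)
  have Hc: "x \<in> carrier G" if "x \<in> H" for x using subgroup.mem_carrier[OF H that] .
  have A: "add_subgroup A" using step.hyps(1) by (rule Z_flag_add_subgroup)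
  have \<phi>1: "\<phi> \<one> = 0" using \<phi>[of \<one> \<one>] subgroup.one_closed[OF H] by simp
  have \<phi>inv: "\<phi> (inv x) = - \<phi> x" if "x \<in> H" for x
    using \<phi>[OF that subgroup.m_inv_closed[OF H that]] Hc[OF that] \<phi>1
    by (simp add: eq_neg_iff_add_eq_0 add.commute)
  have pre: "subgroup {x \<in> H. \<phi> x \<in> C} G" if C: "add_subgroup C" for C
  proof
    show "{x \<in> H. \<phi> x \<in> C} \<subseteq> carrier G" using Hc by blast
    show "\<one> \<in> {x \<in> H. \<phi> x \<in> C}"
      using subgroup.one_closed[OF H] C \<phi>1 by (simp add: add_subgroup_def)
  next
    fix x y assume "x \<in> {x \<in> H. \<phi> x \<in> C}" "y \<in> {x \<in> H. \<phi> x \<in> C}"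
    then show "x \<otimes> y \<in> {x \<in> H. \<phi> x \<in> C}"
      using subgroup.m_closed[OF H] \<phi> add_subgroup_add[OF C] by simp
  next
    fix x assume "x \<in> {x \<in> H. \<phi> x \<in> C}"
    then show "inv x \<in> {x \<in> H. \<phi> x \<in> C}"
      using subgroup.m_inv_closed[OF H] \<phi>inv add_subgroup_minus[OF C] by simp
  qed
  let ?A' = "{a + of_int n *\<^sub>R t |a n. a \<in> A}"
  let ?M = "{x \<in> H. \<phi> x \<in> A}" and ?H' = "{x \<in> H. \<phi> x \<in> ?A'}"
  have A': "add_subgroup ?A'"
    using Z_flag.step[OF step.hyps] by (rule Z_flag_add_subgroup)
  have AA': "A \<subseteq> ?A'"
  proof
    fix a assume "a \<in> A"
    moreover have "a = a + of_int 0 *\<^sub>R t" by simp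
    ultimately show "a \<in> ?A'" by blast
  qed
  then obtain B where B: "iterated_semidirect G {x \<in> H. \<phi> x = 0} B k ?M"
    "\<And>i. i \<in> {1..k} \<Longrightarrow> subgroup (B i) (G\<lparr>carrier := H\<rparr>) \<and> G\<lparr>carrier := B i\<rparr> \<cong> Z_power 1"
    using step.IH step.prems by blast
  have "0 \<in> A" using A by (simp add: add_subgroup_def)
  moreover have "t = 0 + of_int 1 *\<^sub>R t" by simp
  ultimately have tA': "t \<in> ?A'" by blast
  then obtain u where u: "u \<in> H" "\<phi> u = t" using step.prems by blast
  note uc = Hc[OF u(1)]
  define U where "U = range (\<lambda>n::int. u [^] n)"
  have powH: "u [^] n \<in> H" for n :: int
    using subgroup_int_pow_closed[OF H u(1)] .
  have \<phi>pow_nat: "\<phi> (u [^] n) = of_nat n *\<^sub>R t" for n :: nat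
    by (induction n) (use \<phi>1 \<phi> u powH[of "int _"] in \<open>auto simp: int_pow_int scaleR_add_left\<close>)
  have \<phi>pow: "\<phi> (u [^] n) = of_int n *\<^sub>R t" for n :: int
  proof (cases n)
    case (nonneg m)
    then show ?thesis by (simp add: int_pow_int \<phi>pow_nat)
  next
    case (neg m)
    have "\<phi> (inv (u [^] Suc m)) = - \<phi> (u [^] Suc m)"
      using \<phi>inv powH[of "int (Suc m)"] unfolding int_pow_int .
    also have "inv (u [^] Suc m) = u [^] n"
      unfolding neg int_pow_neg_int[OF uc] ..
    finally show ?thesis
      unfolding \<phi>pow_nat neg by (simp del: int_pow_neg_int flip: scaleR_minus_left)
  qed
  have U: "subgroup U G" unfolding U_def using uc by (rule subgroup_int_powers)
  have UH: "U \<subseteq> H" unfolding U_def using powH by blast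
  have UH': "U \<subseteq> ?H'"
    unfolding U_def using powH \<phi>pow add_subgroup_of_int[OF A' tA'] by auto
  have M: "subgroup ?M G" and H': "subgroup ?H' G" using pre A A' by blast+
  have MH': "?M \<subseteq> ?H'" using AA' by blast
  interpret H': group "G\<lparr>carrier := ?H'\<rparr>" using H' by (rule subgroup_imp_group)
  have "semidirect G ?M U ?H'"
    unfolding semidirect_def
  proof (intro conjI)
    show "subgroup ?H' G" by (rule H')
    show "?M \<lhd> G\<lparr>carrier := ?H'\<rparr>"
      unfolding H'.normal_inv_iff
    proof (intro conjI ballI)
      show "subgroup ?M (G\<lparr>carrier := ?H'\<rparr>)" using M H' MH' by (rule subgroup_incl)
      fix x h assume "x \<in> carrier (G\<lparr>carrier := ?H'\<rparr>)" and h: "h \<in> ?M"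
      then have x: "x \<in> ?H'" by simp
      have "inv\<^bsub>G\<lparr>carrier := ?H'\<rparr>\<^esub> x = inv x" using H' x by (rule m_inv_consistent)
      moreover have "x \<otimes> h \<otimes> inv x \<in> ?M"
        using x h subgroup.m_closed[OF H] subgroup.m_inv_closed[OF H] \<phi> \<phi>inv by auto
      ultimately show "x \<otimes>\<^bsub>G\<lparr>carrier := ?H'\<rparr>\<^esub> h \<otimes>\<^bsub>G\<lparr>carrier := ?H'\<rparr>\<^esub> inv\<^bsub>G\<lparr>carrier := ?H'\<rparr>\<^esub> x \<in> ?M"
        by simp
    qed
    show "subgroup U (G\<lparr>carrier := ?H'\<rparr>)" using U H' UH' by (rule subgroup_incl)
    have "x = \<one>" if x: "x \<in> ?M \<inter> U" for x
    proof -
      obtain n :: int where n: "x = u [^] n" using x by (auto simp: U_def)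
      then have "of_int n *\<^sub>R t \<in> A" using x \<phi>pow by auto
      then have "n = 0" by (rule step.hyps(2))
      with n show ?thesis by simp
    qed
    then show "?M \<inter> U = {\<one>}"
      using subgroup.one_closed[OF M] subgroup.one_closed[OF U] by blast
    show "?M <#> U = ?H'"
    proof
      show "?M <#> U \<subseteq> ?H'"
        using MH' UH' subgroup.m_closed[OF H'] unfolding set_mult_def by blast
      show "?H' \<subseteq> ?M <#> U"
      proof
        fix x assume x: "x \<in> ?H'"
        then obtain a n where a: "\<phi> x = a + of_int n *\<^sub>R t" "a \<in> A" by blast
        have "x \<otimes> inv (u [^] n) \<in> ?M"
          using x a powH subgroup.m_closed[OF H] subgroup.m_inv_closed[OF H]
          by (simp add: \<phi> \<phi>inv \<phi>pow)
        moreover have "x = (x \<otimes> inv (u [^] n)) \<otimes> u [^] n"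
          using x Hc powH by (simp add: m_assoc)
        ultimately show "x \<in> ?M <#> U" unfolding set_mult_def U_def by blast
      qed
    qed
  qed
  moreover have "iterated_semidirect G {x \<in> H. \<phi> x = 0} (B(Suc k := U)) k ?M"
    using B(1) by (subst iterated_semidirect_cong[of k _ B]) auto
  ultimately have it: "iterated_semidirect G {x \<in> H. \<phi> x = 0} (B(Suc k := U)) (Suc k) ?H'"
    unfolding iterated_semidirect.simps fun_upd_same by blast
  have iso: "G\<lparr>carrier := U\<rparr> \<cong> Z_power 1"
    unfolding U_def
  proof (rule iso_Z_power_1[OF uc])
    fix n :: int assume "u [^] n = \<one>"
    then have "of_int n *\<^sub>R t = 0" using \<phi>pow[of n] \<phi>1 by simp
    then show "n = 0" using step.hyps(2)[of n] \<open>0 \<in> A\<close> by (simp only:)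
  qed
  have "subgroup ((B(Suc k := U)) i) (G\<lparr>carrier := H\<rparr>) \<and>
      G\<lparr>carrier := (B(Suc k := U)) i\<rparr> \<cong> Z_power 1" if i: "i \<in> {1..Suc k}" for i
  proof (cases "i = Suc k")
    case True
    show ?thesis
      unfolding True fun_upd_same by (rule conjI[OF subgroup_incl[OF U H UH] iso])
  next
    case False
    with i have "i \<in> {1..k}" by simp
    then show ?thesis unfolding fun_upd_other[OF False] by (rule B(2))
  qed
  with it show ?case by blast
qed

lemma group_rank_le_of_Z_flag:
  fixes f :: "'v::real_vector \<Rightarrow> 'a"
  assumes A: "Z_flag A k" and fc: "\<And>x. x \<in> A \<Longrightarrow> f x \<in> carrier G"
    and add: "\<And>x y. x \<in> A \<Longrightarrow> y \<in> A \<Longrightarrow> f (x + y) = f x \<otimes> f y"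
  shows "group_rank G (f ` A) \<le> enat k"
proof -
  obtain S where S: "finite S" "card S \<le> k" "S \<subseteq> A"
    "\<And>C. add_subgroup C \<Longrightarrow> S \<subseteq> C \<Longrightarrow> A \<subseteq> C"
    using Z_flag_generators[OF A] by blast
  have sA: "add_subgroup A" using A by (rule Z_flag_add_subgroup)
  have A0: "0 \<in> A" using sA by (simp add: add_subgroup_def)
  have f0: "f 0 = \<one>" using add[OF A0 A0] fc[OF A0] by simp
  have fneg: "f (- x) = inv (f x)" if "x \<in> A" for x
    using add[of "- x" x] that add_subgroup_minus[OF sA that] f0 fc
    by (intro inv_equality[symmetric]) auto
  have H: "subgroup (f ` A) G"
  proof
    show "f ` A \<subseteq> carrier G" using fc by blast
    show "\<one> \<in> f ` A" using imageI[OF A0, of f] unfolding f0 .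
  next
    fix x y assume "x \<in> f ` A" "y \<in> f ` A"
    then obtain v w where vw: "v \<in> A" "x = f v" "w \<in> A" "y = f w" by blast
    then have "x \<otimes> y = f (v + w)" using add by simp
    moreover have "f (v + w) \<in> f ` A" using add_subgroup_add[OF sA vw(1,3)] by (rule imageI)
    ultimately show "x \<otimes> y \<in> f ` A" by (simp only:)
  next
    fix x assume "x \<in> f ` A"
    then obtain v where v: "v \<in> A" "x = f v" by blast
    then have "inv x = f (- v)" using fneg by simp
    moreover have "f (- v) \<in> f ` A" using add_subgroup_minus[OF sA v(1)] by (rule imageI)
    ultimately show "inv x \<in> f ` A" by (simp only:)
  qed
  have SH: "f ` S \<subseteq> f ` A" using S(3) by blast
  have sub: "subgroup (generate G (f ` S)) G"
  proof (rule generate_is_subgroup)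
    show "f ` S \<subseteq> carrier G" using S(3) fc by auto
  qed
  have gen: "generate G (f ` S) = f ` A"
  proof
    show "generate G (f ` S) \<subseteq> f ` A" using SH H by (rule generate_subgroup_incl)
    have "add_subgroup {x \<in> A. f x \<in> generate G (f ` S)}"
      unfolding add_subgroup_def
    proof (intro conjI ballI; clarsimp)
      show "0 \<in> A \<and> f 0 \<in> generate G (f ` S)" using A0 f0 subgroup.one_closed[OF sub] by simp
      fix x y assume x: "x \<in> A" "f x \<in> generate G (f ` S)" and y: "y \<in> A" "f y \<in> generate G (f ` S)"
      have "f (x - y) = f x \<otimes> inv (f y)"
        using add[OF x(1) add_subgroup_minus[OF sA y(1)]] fneg[OF y(1)] by simp
      then show "x - y \<in> A \<and> f (x - y) \<in> generate G (f ` S)"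
        using x y add_subgroup_diff[OF sA] subgroup.m_closed[OF sub] subgroup.m_inv_closed[OF sub] by simp
    qed
    moreover have "S \<subseteq> {x \<in> A. f x \<in> generate G (f ` S)}"
      using S(3) by (auto intro: generate.incl)
    ultimately have "A \<subseteq> {x \<in> A. f x \<in> generate G (f ` S)}" by (rule S(4))
    then show "f ` A \<subseteq> generate G (f ` S)" by auto
  qed
  have "group_rank G (f ` A) \<le> enat (card (f ` S))"
    unfolding group_rank_def
    by (intro Inf_lower CollectI exI[of _ "f ` S"] conjI refl finite_imageI S(1) SH gen)
  also have "\<dots> \<le> enat k" using card_image_le[OF S(1), of f] S(2) by simp
  finally show ?thesis .
qed

lemma semidirect_trivial:
  assumes H: "subgroup H G"
  shows "semidirect G H {\<one>} H"
proof -
  interpret H: group "G\<lparr>carrier := H\<rparr>" using H by (rule subgroup_imp_group)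
  have "H \<lhd> G\<lparr>carrier := H\<rparr>"
    using H.normal_inv_iff H.subgroup_self H.m_closed H.inv_closed by simp
  moreover have "subgroup {\<one>} (G\<lparr>carrier := H\<rparr>)"
    using H.triv_subgroup by simp
  moreover have "H <#> {\<one>} = H"
    using subgroup.subset[OF H] by (auto simp: set_mult_def subset_iff)
  ultimately show ?thesis
    using H subgroup.one_closed[OF H] by (auto simp: semidirect_def)
qed

lemma Z_power_0: "G\<lparr>carrier := {\<one>}\<rparr> \<cong> Z_power 0"
proof -
  have "(\<lambda>_ i. undefined) \<in> iso (G\<lparr>carrier := {\<one>}\<rparr>) (Z_power 0)"
    by (auto simp: iso_def hom_def bij_betw_def Z_power_def)
  then show ?thesis unfolding is_iso_def by blast
qed

end

section \<open>Discrete subgroups of the Heisenberg group\<close>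

type_synonym triple = "complex \<times> complex \<times> complex"

text \<open>The triple \<open>(a, b, c)\<close> stands for the unipotent matrix \<open>heis a b c\<close>, and \<open>act\<close> is its
  action on the points \<open>[x : y : 1]\<close>.\<close>

fun hmul :: "triple \<Rightarrow> triple \<Rightarrow> triple" where
  "hmul (a, b, c) (a', b', c') = (a + a', b + b' + a * c', c + c')"

fun hinv :: "triple \<Rightarrow> triple" where
  "hinv (a, b, c) = (- a, a * c - b, - c)"

fun act :: "triple \<Rightarrow> complex \<times> complex \<Rightarrow> complex \<times> complex" where
  "act (a, b, c) (x, y) = (x + a * y + b, y + c)"

locale heis_lattice =
  fixes H :: "triple set"
  assumes one: "(0, 0, 0) \<in> H"
    and mul: "h \<in> H \<Longrightarrow> k \<in> H \<Longrightarrow> hmul h k \<in> H"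
    and inv: "h \<in> H \<Longrightarrow> hinv h \<in> H"
    and disc: "discrete_at_0 H"
begin

definition "Ker = {(a, b) |a b. (a, b, 0) \<in> H}"
definition "Img = {c |a b c. (a, b, c) \<in> H}"
definition "Cen = {b. (0, b, 0) \<in> H}"

lemma add_subgroup_Ker: "add_subgroup Ker"
proof -
  have "(a - a', b - b', 0) \<in> H" if "(a, b, 0) \<in> H" "(a', b', 0) \<in> H" for a b a' b'
    using mul[OF that(1) inv[OF that(2)]] by simp
  then show ?thesis using one by (auto simp: add_subgroup_def Ker_def zero_prod_def)
qed

lemma add_subgroup_Img: "add_subgroup Img"
proof -
  have "c - c' \<in> Img" if "(a, b, c) \<in> H" "(a', b', c') \<in> H" for a b c a' b' c'
    using mul[OF that(1) inv[OF that(2)]] by (auto simp: Img_def)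
  then show ?thesis using one by (auto simp: add_subgroup_def Img_def)
qed

lemma add_subgroup_Cen: "add_subgroup Cen"
proof -
  have "b - b' \<in> Cen" if "(0, b, 0) \<in> H" "(0, b', 0) \<in> H" for b b'
    using mul[OF that(1) inv[OF that(2)]] by (auto simp: Cen_def)
  then show ?thesis using one by (auto simp: add_subgroup_def Cen_def)
qed

lemma discrete_Ker: "discrete_at_0 Ker"
proof -
  obtain e where e: "e > 0" "\<And>h. h \<in> H \<Longrightarrow> norm h < e \<Longrightarrow> h = 0"
    using disc by (auto simp: discrete_at_0_def)
  have "x = 0" if "x \<in> Ker" "norm x < e" for x
    using e(2)[of "(fst x, snd x, 0)"] that
    by (auto simp: Ker_def zero_prod_def norm_prod_def)
  with e(1) show ?thesis unfolding discrete_at_0_def by blast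
qed

lemma discrete_Cen: "discrete_at_0 Cen"
proof -
  obtain e where e: "e > 0" "\<And>h. h \<in> H \<Longrightarrow> norm h < e \<Longrightarrow> h = 0"
    using disc by (auto simp: discrete_at_0_def)
  have "x = 0" if "x \<in> Cen" "norm x < e" for x
    using e(2)[of "(0, x, 0)"] that
    by (auto simp: Cen_def zero_prod_def norm_prod_def)
  with e(1) show ?thesis unfolding discrete_at_0_def by blast
qed

text \<open>Two elements of \<open>H\<close> in a bounded set whose difference is small differ by a
  small element of the group.\<close>

lemma finite_bounded: "finite {(a, b, c) \<in> H. norm a \<le> R \<and> norm b \<le> R \<and> norm c \<le> R}" (is "finite ?S")
proof (cases "R \<ge> 0")
  case R: True
  obtain e where e: "e > 0" "\<And>h. h \<in> H \<Longrightarrow> norm h < e \<Longrightarrow> h = 0"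
    using disc by (auto simp: discrete_at_0_def)
  define d where "d = e / (4 + R)"
  have d: "d > 0" using e(1) R by (simp add: d_def)
  have eq: "h = h'" if hS: "h \<in> ?S" "h' \<in> ?S" and dist: "dist h h' < d" for h h'
  proof -
    obtain a b c a' b' c' where h: "h = (a, b, c)" "h' = (a', b', c')" by (metis prod_cases3)
    have "norm (a' - a, b' - b, c' - c) < d"
      using dist unfolding dist_commute[of h] by (simp add: h dist_norm)
    then have small: "norm (a' - a) < d" "norm (b' - b) < d" "norm (c' - c) < d"
      using norm_fst_le[of "a' - a" "(b' - b, c' - c)"] norm_snd_le[of "(b' - b, c' - c)" "a' - a"]
        norm_fst_le[of "b' - b" "c' - c"] norm_snd_le[of "c' - c" "b' - b"] by linarith+
    have m: "(a' - a, b' - b - a * (c' - c), c' - c) \<in> H"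
      using mul[OF inv[of h], of h'] hS by (auto simp: h algebra_simps)
    have "norm (a * (c' - c)) \<le> R * d"
      using hS small(3) R by (auto simp: h norm_mult intro!: mult_mono)
    then have "norm (b' - b - a * (c' - c)) < d + R * d"
      using small(2) norm_triangle_ineq4[of "b' - b" "a * (c' - c)"] by linarith
    then have "norm (a' - a, b' - b - a * (c' - c), c' - c) < d + (d + R * d) + d"
      using small norm_Pair_le[of "a' - a" "(b' - b - a * (c' - c), c' - c)"]
        norm_Pair_le[of "b' - b - a * (c' - c)" "c' - c"] by linarith
    also have "\<dots> \<le> (4 + R) * d" using d by (simp add: algebra_simps)
    also have "\<dots> = e" using R by (simp add: d_def)
    finally have "(a' - a, b' - b - a * (c' - c), c' - c) = 0" using e(2) m by blast
    then show "h = h'" by (auto simp: h zero_prod_def)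
  qed
  have "uniform_discrete ?S" unfolding uniform_discrete_def using eq d by blast
  moreover have "bounded ?S"
  proof (rule bounded_subset)
    show "bounded (cball 0 R \<times> cball 0 R \<times> cball (0::complex) R :: triple set)"
      by (intro bounded_Times bounded_cball)
  qed auto
  ultimately show ?thesis using uniform_discrete_finite_iff by blast
next
  case False
  then have "?S = {}" by (auto dest: order_trans[OF norm_ge_zero])
  then show ?thesis by (simp only: finite.emptyI)
qed

text \<open>The commutator of \<open>(a, b, 0)\<close> with an element over \<open>c\<close> is \<open>(0, a c, 0)\<close>.\<close>

lemma Cen_mult_Img:
  assumes "(a, b) \<in> Ker" "c \<in> Img"
  shows "a * c \<in> Cen"
proof -
  obtain a' b' where h: "(a', b', c) \<in> H" using assms(2) by (auto simp: Img_def)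
  have k: "(a, b, 0) \<in> H" using assms(1) by (auto simp: Ker_def)
  have eq: "hmul (hmul (a, b, 0) (a', b', c)) (hinv (hmul (a', b', c) (a, b, 0))) = (0, a * c, 0)"
    by (simp add: algebra_simps)
  from mul[OF mul[OF k h] inv[OF mul[OF h k]]] show ?thesis unfolding eq by (simp add: Cen_def)
qed

lemma commutator_in_Cen:
  assumes h: "(a, b, c) \<in> H" and h': "(a', b', c') \<in> H"
  shows "a * c' - a' * c \<in> Cen"
proof -
  have eq: "hmul (hmul (a, b, c) (a', b', c')) (hinv (hmul (a', b', c') (a, b, c))) = (0, a * c' - a' * c, 0)"
    by (simp add: algebra_simps)
  from mul[OF mul[OF h h'] inv[OF mul[OF h' h]]] show ?thesis unfolding eq by (simp add: Cen_def)
qed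

lemma Img_discrete_if_Ker_nontrivial:
  assumes k: "(a, b) \<in> Ker" and a: "a \<noteq> 0"
  shows "discrete_at_0 Img"
proof -
  obtain e where e: "e > 0" "\<And>x. x \<in> Cen \<Longrightarrow> norm x < e \<Longrightarrow> x = 0"
    using discrete_Cen by (auto simp: discrete_at_0_def)
  have "c = 0" if "c \<in> Img" "norm c < e / norm a" for c
  proof -
    have "norm (a * c) < e" using that(2) a by (simp add: norm_mult field_simps)
    then show ?thesis using e(2)[OF Cen_mult_Img[OF k that(1)]] a by simp
  qed
  moreover have "e / norm a > 0" using e(1) a by simp
  ultimately show ?thesis unfolding discrete_at_0_def by blast
qed

lemma Ker_flag: "\<exists>r\<le>4. Z_flag Ker r"
proof -
  have "dim Ker \<le> 4" using dim_subset_UNIV[of Ker] by simp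
  then show ?thesis
    using discrete_subgroup_Z_flag[OF add_subgroup_Ker discrete_Ker] by (meson order_trans)
qed

lemma Img_flag:
  assumes "discrete_at_0 Img"
  shows "\<exists>m\<le>2. Z_flag Img m"
proof -
  have "dim Img \<le> 2" using dim_subset_UNIV[of Img] by simp
  then show ?thesis
    using discrete_subgroup_Z_flag[OF add_subgroup_Img assms] by (meson order_trans)
qed

end

context heis_lattice
begin

text \<open>The image of \<open>H\<close> in the quotient of the Heisenberg group by its center.\<close>

definition "Ab = {(a, c) |a b c. (a, b, c) \<in> H}"

lemma Ker_flag_central:
  assumes "\<And>a b. (a, b) \<in> Ker \<Longrightarrow> a = 0"
  shows "\<exists>r\<le>dim Cen. Z_flag Ker r"
proof -
  have K: "Ker = (\<lambda>b. (0, b)) ` Cen"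
    using assms by (auto simp: Ker_def Cen_def image_iff)
  obtain r where "r \<le> dim Cen" "Z_flag Cen r"
    using discrete_subgroup_Z_flag[OF add_subgroup_Cen discrete_Cen] by blast
  then show ?thesis unfolding K
    by (intro exI[of _ r] conjI Z_flag_image) (auto simp: zero_prod_def)
qed

text \<open>In exponential coordinates \<open>\<beta> = b - a c / 2\<close> the group law is addition plus half of a commutator, so
  projecting \<open>\<beta>\<close> along the span of \<open>Cen\<close> yields a homomorphism \<open>F\<close>. Its image \<open>D\<close>
  is a discrete subgroup of a real vector space of dimension at most \<open>dim Ab + 2 - dim Cen\<close>, and reading off
  \<open>c\<close> maps \<open>D\<close> isomorphically onto \<open>Img\<close>, even where \<open>Img\<close> itself is dense.\<close>

lemma Img_flag_central:
  assumes central: "\<And>a b. (a, b) \<in> Ker \<Longrightarrow> a = 0"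
  shows "\<exists>m. m + dim Cen \<le> dim Ab + 2 \<and> Z_flag Img m"
proof -
  obtain \<pi> :: "complex \<Rightarrow> complex" where \<pi>: "linear \<pi>" "\<And>x. x - \<pi> x \<in> span Cen"
    "\<And>x. x \<in> span Cen \<Longrightarrow> \<pi> x = 0" "dim (range \<pi>) + dim (span Cen) \<le> DIM(complex)"
    using exists_projection_along[OF subspace_span, of Cen] by blast
  define F :: "triple \<Rightarrow> (complex \<times> complex) \<times> complex" where
    "F = (\<lambda>(a, b, c). ((a, c), \<pi> (b - a * c / 2)))"
  define D where "D = F ` H"
  have diff: "F (hmul h (hinv k)) = F h - F k" if h: "h \<in> H" and k: "k \<in> H" for h k
  proof -
    obtain a b c a' b' c' where hk: "h = (a, b, c)" "k = (a', b', c')" by (metis prod_cases3)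
    have "a' * c - a * c' \<in> Cen" using commutator_in_Cen h k hk by blast
    then have "(1/2) *\<^sub>R (a' * c - a * c') \<in> span Cen" by (intro span_scale span_base)
    then have 0: "\<pi> ((1/2) *\<^sub>R (a' * c - a * c')) = 0" by (rule \<pi>(3))
    have "\<pi> (b + (a' * c' - b') - a * c' - (a - a') * (c - c') / 2)
        = \<pi> ((b - a * c / 2) - (b' - a' * c' / 2) + (1/2) *\<^sub>R (a' * c - a * c'))"
      by (rule arg_cong[of _ _ \<pi>]) (simp add: field_simps scaleR_conv_of_real)
    also have "\<dots> = \<pi> (b - a * c / 2) - \<pi> (b' - a' * c' / 2)"
      using 0 \<pi>(1) by (simp add: linear_add linear_diff)
    finally show ?thesis by (simp add: hk F_def add.commute)
  qed
  have D: "add_subgroup D"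
    unfolding add_subgroup_def D_def
  proof (intro conjI ballI)
    have "F (0, 0, 0) = 0" using \<pi>(1) by (simp add: F_def zero_prod_def linear_0)
    then show "0 \<in> F ` H" using one by (metis imageI)
    show "x - y \<in> F ` H" if "x \<in> F ` H" "y \<in> F ` H" for x y
      using that diff mul inv by (metis (no_types, lifting) image_iff)
  qed
  obtain M where M: "M \<ge> 0" "\<And>v. v \<in> span Cen \<Longrightarrow> \<exists>x\<in>Cen. norm (v - x) \<le> M"
    using add_subgroup_cobounded[OF add_subgroup_Cen] by blast
  \<comment> \<open>Multiplying by a central element does not change \<open>F\<close>, so representatives may be chosen bounded.\<close>
  have "{x \<in> D. norm x < 1} \<subseteq> F ` {(a, b, c) \<in> H. norm a \<le> M + 2 \<and> norm b \<le> M + 2 \<and> norm c \<le> M + 2}"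
  proof
    fix x assume x: "x \<in> {x \<in> D. norm x < 1}"
    then obtain a b c where h: "(a, b, c) \<in> H" "x = F (a, b, c)" by (auto simp: D_def)
    define \<beta> where "\<beta> = b - a * c / 2"
    obtain l where l: "l \<in> Cen" "norm (\<beta> - \<pi> \<beta> - l) \<le> M" using M(2) \<pi>(2) by blast
    have "hmul (a, b, c) (hinv (0, l, 0)) \<in> H" using h(1) l(1) by (intro mul inv) (simp_all add: Cen_def)
    then have h': "(a, b - l, c) \<in> H" by simp
    have "\<pi> l = 0" using l(1) by (intro \<pi>(3) span_base)
    moreover have "b - l - a * c / 2 = \<beta> - l" by (simp add: \<beta>_def)
    ultimately have "F (a, b - l, c) = x"
      using \<pi>(1) by (simp add: h(2) F_def linear_diff \<beta>_def)
    moreover have x1: "norm ((a, c), \<pi> \<beta>) < 1" using x by (simp add: h(2) F_def \<beta>_def)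
    then have "norm (a, c) < 1" and nb: "norm (\<pi> \<beta>) < 1"
      using norm_fst_le[of "(a, c)" "\<pi> \<beta>"] norm_snd_le[of "\<pi> \<beta>" "(a, c)"] by linarith+
    then have na: "norm a < 1" and nc: "norm c < 1"
      using norm_fst_le[of a c] norm_snd_le[of c a] by linarith+
    have "norm (a * c) \<le> 1 * 1" unfolding norm_mult using na nc by (intro mult_mono) auto
    then have nac: "norm (a * c / 2) \<le> 1/2" by (simp add: norm_divide)
    have "b - l = (\<beta> - \<pi> \<beta> - l) + \<pi> \<beta> + a * c / 2" by (simp add: \<beta>_def)
    then have "norm (b - l) \<le> norm (\<beta> - \<pi> \<beta> - l) + norm (\<pi> \<beta>) + norm (a * c / 2)"
      by (metis norm_triangle_le norm_triangle_ineq add_right_mono order_trans)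
    then have "norm (b - l) \<le> M + 2" using l(2) nb nac by linarith
    then have "(a, b - l, c) \<in> {(a, b, c) \<in> H. norm a \<le> M + 2 \<and> norm b \<le> M + 2 \<and> norm c \<le> M + 2}"
      using h' na nc M(1) by simp
    ultimately show "x \<in> F ` {(a, b, c) \<in> H. norm a \<le> M + 2 \<and> norm b \<le> M + 2 \<and> norm c \<le> M + 2}"
      by blast
  qed
  then have "finite {x \<in> D. norm x < 1}" by (rule finite_subset) (intro finite_imageI finite_bounded)
  then have disc: "discrete_at_0 D" by (rule finite_ball_imp_discrete_at_0) simp
  obtain m where m: "m \<le> dim D" "Z_flag D m"
    using discrete_subgroup_Z_flag[OF D disc] by blast
  have "Z_flag ((\<lambda>x. snd (fst x)) ` D) m"
  proof (rule Z_flag_image[OF m(2)])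
    fix x assume "x \<in> D" "snd (fst x) = 0"
    then obtain a b where h: "(a, b, 0) \<in> H" and x: "x = F (a, b, 0)" by (auto simp: D_def F_def)
    from h have "a = 0" by (intro central[of a b]) (simp add: Ker_def)
    with h have "b \<in> Cen" by (simp add: Cen_def)
    then have "\<pi> b = 0" by (intro \<pi>(3) span_base)
    with \<open>a = 0\<close> x show "x = 0" by (simp add: F_def zero_prod_def)
  qed simp
  moreover have "(\<lambda>x. snd (fst x)) ` D = Img"
    by (force simp: D_def F_def Img_def image_iff)
  moreover have "m + dim Cen \<le> dim Ab + 2"
  proof -
    have "D \<subseteq> span Ab \<times> range \<pi>"
      by (auto simp: D_def F_def Ab_def intro!: span_base)
    then have "dim D \<le> dim (span Ab \<times> range \<pi>)" by (rule dim_subset)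
    also have "\<dots> = dim (span Ab) + dim (range \<pi>)"
      using \<pi>(1) by (intro dim_Times subspace_span linear_subspace_image subspace_UNIV)
    finally show ?thesis using m(1) \<pi>(4) by simp
  qed
  ultimately show ?thesis by auto
qed

text \<open>All commutators lie in \<open>Cen\<close>, hence are orthogonal to some \<open>u \<noteq> 0\<close> when \<open>Cen\<close> does not span \<open>\<complex>\<close>.\<close>

lemma dim_Ab_le:
  assumes "span Cen \<noteq> UNIV"
  shows "dim Ab \<le> 2"
proof -
  have "dim Cen < DIM(complex)"
    using assms dim_eq_full[of Cen] dim_subset_UNIV[of Cen] by (simp add: order_less_le)
  then obtain u where u: "u \<noteq> 0" "\<And>y. y \<in> span Cen \<Longrightarrow> orthogonal u y"
    using orthogonal_to_subspace_exists[of Cen] by blast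
  have "inner u (a * c' - a' * c) = 0" if ac: "(a, c) \<in> Ab" "(a', c') \<in> Ab" for a c a' c'
  proof -
    obtain b b' where "(a, b, c) \<in> H" "(a', b', c') \<in> H" using ac by (auto simp: Ab_def)
    then have "a * c' - a' * c \<in> Cen" by (rule commutator_in_Cen)
    then show ?thesis using u(2)[OF span_base] by (simp add: orthogonal_def)
  qed
  then show ?thesis using complex_isotropic_dim_le[OF u(1)] by blast
qed

lemma rank_bound_central:
  assumes "\<And>a b. (a, b) \<in> Ker \<Longrightarrow> a = 0"
  shows "\<exists>r m. Z_flag Ker r \<and> Z_flag Img m \<and> r + m \<le> 6 \<and> (span Cen \<noteq> UNIV \<longrightarrow> r + m \<le> 4)"
proof -
  obtain r where r: "r \<le> dim Cen" "Z_flag Ker r" using Ker_flag_central assms by blast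
  obtain m where m: "m + dim Cen \<le> dim Ab + 2" "Z_flag Img m" using Img_flag_central assms by blast
  have "dim Ab \<le> 4" using dim_subset_UNIV[of Ab] by simp
  then have "r + m \<le> 6" using r(1) m(1) by linarith
  moreover have "r + m \<le> 4" if "span Cen \<noteq> UNIV"
    using dim_Ab_le[OF that] r(1) m(1) by linarith
  ultimately show ?thesis using r(2) m(2) by blast
qed

lemma rank_bound: "\<exists>r m. Z_flag Ker r \<and> Z_flag Img m \<and> r + m \<le> 6"
proof (cases "\<forall>a b. (a, b) \<in> Ker \<longrightarrow> a = 0")
  case True
  then show ?thesis using rank_bound_central by blast
next
  case False
  then have "discrete_at_0 Img" using Img_discrete_if_Ker_nontrivial by blast
  then obtain m where "m \<le> 2" "Z_flag Img m" using Img_flag by blast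
  moreover obtain r where "r \<le> 4" "Z_flag Ker r" using Ker_flag by blast
  ultimately show ?thesis by (intro exI[of _ r] exI[of _ m]) auto
qed

end

section \<open>Properly discontinuous affine actions\<close>

locale proper_heis_lattice = heis_lattice +
  fixes U :: "(complex \<times> complex) set"
  assumes U: "open U" "U \<noteq> {}"
    and pd: "compact C \<Longrightarrow> C \<subseteq> U \<Longrightarrow> finite {h \<in> H. act h ` C \<inter> C \<noteq> {}}"
begin

lemma proper_ball:
  "\<exists>x y e. e > 0 \<and> finite {h \<in> H. \<exists>v. dist (x, y) v \<le> e \<and> dist (x, y) (act h v) \<le> e}"
proof -
  obtain p where "p \<in> U" using U(2) by blast
  then obtain e where e: "e > 0" "cball p e \<subseteq> U" using U(1) open_contains_cball by blast
  have "finite {h \<in> H. act h ` cball p e \<inter> cball p e \<noteq> {}}" using e(2) by (intro pd) auto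
  moreover have "{h \<in> H. \<exists>v. dist p v \<le> e \<and> dist p (act h v) \<le> e} \<subseteq> {h \<in> H. act h ` cball p e \<inter> cball p e \<noteq> {}}"
  proof (intro subsetI CollectI; elim CollectE conjE exE; intro conjI)
    fix h v assume "dist p v \<le> e" "dist p (act h v) \<le> e"
    then have "act h v \<in> act h ` cball p e \<inter> cball p e" by simp
    then show "act h ` cball p e \<inter> cball p e \<noteq> {}" by blast
  qed
  ultimately have "finite {h \<in> H. \<exists>v. dist p v \<le> e \<and> dist p (act h v) \<le> e}" by (rule finite_subset[rotated])
  with e(1) show ?thesis by (cases p) auto
qed

text \<open>The kernel acts on the line over \<open>y\<close> by the translations \<open>a y + b\<close>. Proper discontinuity
  makes this action faithful (the powers of an element fixing a point of the open set would be infinitely many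
  elements that do not move a small ball around it off itself) and the translations discrete in \<open>\<complex>\<close>, which has real dimension 2.\<close>

lemma Ker_flag_proper: "\<exists>r\<le>2. Z_flag Ker r"
proof -
  obtain x y e where e: "e > 0"
    and fin: "finite {h \<in> H. \<exists>v. dist (x, y) v \<le> e \<and> dist (x, y) (act h v) \<le> e}" (is "finite ?F")
    using proper_ball by blast
  define f :: "complex \<times> complex \<Rightarrow> complex" where "f = (\<lambda>(a, b). a * y + b)"
  have f_add: "f (v + w) = f v + f w" for v w by (auto simp: f_def case_prod_beta algebra_simps)
  have f_diff: "f (v - w) = f v - f w" for v w by (auto simp: f_def case_prod_beta algebra_simps)
  have memF: "(fst v, snd v, 0) \<in> ?F" if v: "v \<in> Ker" "norm (f v) \<le> e" for v
  proof -
    have "(fst v, snd v, 0) \<in> H" using v(1) by (auto simp: Ker_def)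
    moreover have "act (fst v, snd v, 0) (x, y) = (x + f v, y)"
      by (simp add: f_def case_prod_beta)
    then have "dist (x, y) (act (fst v, snd v, 0) (x, y)) \<le> e"
      using v(2) by (simp only: dist_Pair_Pair) (simp add: dist_norm)
    moreover have "dist (x, y) (x, y) \<le> e" using e by simp
    ultimately show ?thesis by blast
  qed
  have inj: "v = 0" if v: "v \<in> Ker" "f v = 0" for v
  proof (rule ccontr)
    assume "v \<noteq> 0"
    have "inj (\<lambda>n::nat. of_nat n *\<^sub>R v)" using \<open>v \<noteq> 0\<close> by (auto simp: inj_def)
    then have "infinite (range (\<lambda>n::nat. of_nat n *\<^sub>R v))" by (rule range_inj_infinite)
    moreover have "range (\<lambda>n::nat. of_nat n *\<^sub>R v) \<subseteq> (\<lambda>(a, b, c). (a, b)) ` ?F"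
    proof
      fix w assume "w \<in> range (\<lambda>n::nat. of_nat n *\<^sub>R v)"
      then obtain n :: nat where w: "w = of_nat n *\<^sub>R v" by blast
      have "f w = of_nat n *\<^sub>R f v"
        by (simp add: w f_def case_prod_beta scaleR_conv_of_real algebra_simps)
      then have "norm (f w) \<le> e" using v(2) e by simp
      moreover have "w \<in> Ker" unfolding w using add_subgroup_Ker v(1) by (rule add_subgroup_of_nat)
      ultimately have "(fst w, snd w, 0) \<in> ?F" by (intro memF)
      then show "w \<in> (\<lambda>(a, b, c). (a, b)) ` ?F" by (rule rev_image_eqI) simp
    qed
    ultimately show False using fin by (meson finite_imageI finite_subset)
  qed
  have sub: "add_subgroup (f ` Ker)"
    unfolding add_subgroup_def
  proof (intro conjI ballI)
    have "f 0 = 0" by (simp add: f_def zero_prod_def)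
    then show "0 \<in> f ` Ker" using add_subgroup_Ker by (metis add_subgroup_def imageI)
    show "s - t \<in> f ` Ker" if "s \<in> f ` Ker" "t \<in> f ` Ker" for s t
      using that f_diff add_subgroup_diff[OF add_subgroup_Ker] by (metis (no_types, lifting) image_iff)
  qed
  have "{s \<in> f ` Ker. norm s < e} \<subseteq> (\<lambda>(a, b, c). f (a, b)) ` ?F"
  proof
    fix s assume "s \<in> {s \<in> f ` Ker. norm s < e}"
    then obtain v where "v \<in> Ker" "s = f v" "norm (f v) \<le> e" by auto
    then show "s \<in> (\<lambda>(a, b, c). f (a, b)) ` ?F" using memF[of v] by force
  qed
  then have "finite {s \<in> f ` Ker. norm s < e}" using fin by (meson finite_imageI finite_subset)
  then have "discrete_at_0 (f ` Ker)" using e by (rule finite_ball_imp_discrete_at_0)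
  with sub obtain r where r: "r \<le> dim (f ` Ker)" "Z_flag (f ` Ker) r"
    using discrete_subgroup_Z_flag by blast
  have inj_on: "inj_on f Ker"
  proof (rule inj_onI)
    fix v w assume "v \<in> Ker" "w \<in> Ker" "f v = f w"
    then show "v = w" using inj[OF add_subgroup_diff[OF add_subgroup_Ker, of v w]] f_diff by simp
  qed
  \<comment> \<open>The rank of \<open>f ` Ker\<close> is bounded by the dimension of \<open>\<complex>\<close>; pull the flag back to \<open>Ker\<close>.\<close>
  define g where "g = the_inv_into Ker f"
  have g: "g (f v) = v" if "v \<in> Ker" for v
    unfolding g_def using inj_on that by (rule the_inv_into_f_f)
  have "Z_flag (g ` f ` Ker) r"
  proof (rule Z_flag_image[OF r(2)])
    fix s t assume "s \<in> f ` Ker" "t \<in> f ` Ker"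
    then obtain v w where "v \<in> Ker" "s = f v" "w \<in> Ker" "t = f w" by blast
    then show "g (s + t) = g s + g t"
      using g add_subgroup_add[OF add_subgroup_Ker] f_add by metis
  next
    fix s assume "s \<in> f ` Ker" "g s = 0"
    then show "s = 0" using g by (auto simp: f_def zero_prod_def)
  qed
  moreover have "g ` f ` Ker = Ker" using g by force
  moreover have "r \<le> 2" using r(1) dim_subset_UNIV[of "f ` Ker"] by simp
  ultimately show ?thesis by auto
qed

text \<open>Take an element over a small \<open>c\<close>. If \<open>a\<close> is bounded, a central factor makes \<open>b\<close> bounded too,
  which leaves finitely many elements. If \<open>a\<close> is large, the translation \<open>a y + b\<close>, taken modulo the
  cocompact group \<open>Cen\<close>, can be made to vanish by moving \<open>y\<close> by a small amount; a central
  multiple of the element then moves some point near \<open>(x, y)\<close> by \<open>c\<close> only, and proper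
  discontinuity leaves finitely many possibilities.\<close>

lemma Img_discrete_proper:
  assumes central: "\<And>a b. (a, b) \<in> Ker \<Longrightarrow> a = 0" and full: "span Cen = UNIV"
  shows "discrete_at_0 Img"
proof -
  obtain x y e where e: "e > 0"
    and fin: "finite {h \<in> H. \<exists>v. dist (x, y) v \<le> e \<and> dist (x, y) (act h v) \<le> e}" (is "finite ?F")
    using proper_ball by blast
  obtain M where M: "M \<ge> 0" "\<And>v. \<exists>l\<in>Cen. norm (v - l) \<le> M"
    using add_subgroup_cobounded[OF add_subgroup_Cen] full by auto
  \<comment> \<open>For \<open>norm a > 2 * M / e\<close>, changing \<open>y\<close> by \<open>e / 2\<close> changes \<open>a * y\<close> by more than \<open>M\<close>;
    the other terms bound \<open>b - l\<close> and \<open>c\<close>.\<close>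
  define R where "R = max (2 * M / e) (max M (e / 2))"
  have shift: "(a, b - l, c) \<in> H" if "(a, b, c) \<in> H" "l \<in> Cen" for a b c l
  proof -
    have "hmul (a, b, c) (hinv (0, l, 0)) \<in> H" using that by (intro mul inv) (simp_all add: Cen_def)
    then show ?thesis by simp
  qed
  let ?S = "{(a, b, c) \<in> H. norm a \<le> R \<and> norm b \<le> R \<and> norm c \<le> R}"
  have "{c \<in> Img. norm c < e / 2} \<subseteq> (\<lambda>(a, b, c). c) ` (?F \<union> ?S)"
  proof
    fix c assume "c \<in> {c \<in> Img. norm c < e / 2}"
    then obtain a b where h: "(a, b, c) \<in> H" and c: "norm c < e / 2" by (auto simp: Img_def)
    show "c \<in> (\<lambda>(a, b, c). c) ` (?F \<union> ?S)"
    proof (cases "norm a \<le> R")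
      case True
      obtain l where l: "l \<in> Cen" "norm (b - l) \<le> M" using M(2) by blast
      have "(a, b - l, c) \<in> ?S" using shift[OF h l(1)] True l(2) c by (auto simp: R_def)
      then show ?thesis by force
    next
      case False
      obtain l where l: "l \<in> Cen" "norm (a * y + b - l) \<le> M" using M(2) by blast
      have a: "norm a > 2 * M / e" "a \<noteq> 0" using False e M(1) by (auto simp: R_def)
      \<comment> \<open>With this \<open>y'\<close>, the element \<open>(a, b - l, c)\<close> does not change the first coordinate of \<open>(x, y')\<close>.\<close>
      define y' where "y' = y - (a * y + b - l) / a"
      have "norm (y - y') \<le> M / norm a" using l(2) a(2) by (simp add: y'_def norm_divide divide_right_mono)
      also have "\<dots> \<le> e / 2" using a e by (simp add: field_simps)
      finally have y': "norm (y - y') \<le> e / 2" .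
      have act: "act (a, b - l, c) (x, y') = (x, y' + c)"
        using a(2) by (simp add: y'_def field_simps)
      have "norm (y - (y' + c)) \<le> norm (y - y') + norm c"
        using norm_triangle_ineq4[of "y - y'" c] by (simp add: algebra_simps)
      then have "dist (x, y) (act (a, b - l, c) (x, y')) \<le> e"
        unfolding act using y' c by (simp add: dist_Pair_Pair dist_norm)
      moreover have "dist (x, y) (x, y') \<le> e" using y' e by (simp add: dist_Pair_Pair dist_norm)
      ultimately have "(a, b - l, c) \<in> ?F" using shift[OF h l(1)] by blast
      then show ?thesis by force
    qed
  qed
  then have "finite {c \<in> Img. norm c < e / 2}"
    by (rule finite_subset) (intro finite_imageI finite_UnI fin finite_bounded)
  then show ?thesis by (rule finite_ball_imp_discrete_at_0) (use e in simp)
qed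

lemma rank_bound_proper: "\<exists>r m. Z_flag Ker r \<and> Z_flag Img m \<and> r + m \<le> 4"
proof (cases "(\<forall>a b. (a, b) \<in> Ker \<longrightarrow> a = 0) \<and> span Cen \<noteq> UNIV")
  case True
  then show ?thesis using rank_bound_central by blast
next
  case False
  then have "discrete_at_0 Img" using Img_discrete_if_Ker_nontrivial Img_discrete_proper by blast
  then obtain m where "m \<le> 2" "Z_flag Img m" using Img_flag by blast
  moreover obtain r where "r \<le> 2" "Z_flag Ker r" using Ker_flag_proper by blast
  ultimately show ?thesis by (intro exI[of _ r] exI[of _ m]) auto
qed

end

section \<open>The Heisenberg group in PSL(3,C)\<close>

text \<open>The parametrization of \<open>Heis\<close> by triples; it is an injective homomorphism, which is how \<open>G\<close> and its set of
  triples are identified.\<close>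

definition heis_class :: "triple \<Rightarrow> (complex^3^3) set" where
  "heis_class = (\<lambda>(a, b, c). psl_class (heis a b c))"

lemma heis_entries:
  "heis a b c $ 1 $ 1 = 1" "heis a b c $ 1 $ 2 = a" "heis a b c $ 1 $ 3 = b"
  "heis a b c $ 2 $ 1 = 0" "heis a b c $ 2 $ 2 = 1" "heis a b c $ 2 $ 3 = c"
  "heis a b c $ 3 $ 1 = 0" "heis a b c $ 3 $ 2 = 0" "heis a b c $ 3 $ 3 = 1"
  by (simp_all add: heis_def)

lemma det_heis: "det (heis a b c) = 1"
  by (simp add: det_3 heis_entries)

lemma heis_mult: "heis a b c ** heis a' b' c' = heis (a + a') (b + b' + a * c') (c + c')"
  by (simp add: matrix_matrix_mult_def vec_eq_iff forall_3 sum_3 heis_entries)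

lemma heis_0: "heis 0 0 0 = mat 1"
  by (simp add: vec_eq_iff forall_3 heis_entries mat_def)

lemma heis_mult_vec:
  "heis a b c *v v = vector [v $ 1 + a * v $ 2 + b * v $ 3, v $ 2 + c * v $ 3, v $ 3]"
  by (simp add: matrix_vector_mult_def vec_eq_iff forall_3 sum_3 heis_entries)

lemma mem_psl_class: "B \<in> psl_class A \<longleftrightarrow> (\<exists>d. mat d \<in> (scalars :: (complex^'n^'n) set) \<and> B = mat d ** A)"
  for A :: "complex^'n^'n"
  by (auto simp: psl_class_def r_coset_def scalars_def)

lemma psl_class_self: "A \<in> psl_class A"
  unfolding mem_psl_class by (rule exI[of _ 1]) (auto simp: scalars_def)

lemma psl_class_heis_eqD:
  assumes "psl_class (heis a b c) = psl_class (heis a' b' c')"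
  shows "a = a' \<and> b = b' \<and> c = c'"
proof -
  obtain d where d: "heis a b c = mat d ** heis a' b' c'"
    using psl_class_self[of "heis a b c"] assms by (auto simp: mem_psl_class)
  then have e: "heis a b c $ i $ j = d * heis a' b' c' $ i $ j" for i j
    by (simp add: mat_mult_left)
  have "d = 1" using e[of 1 1] by (simp add: heis_entries)
  then show ?thesis using e[of 1 2] e[of 1 3] e[of 2 3] by (simp add: heis_entries)
qed

lemma inj_heis_class: "inj heis_class"
  by (auto simp: inj_def heis_class_def dest: psl_class_heis_eqD)

lemma psl_class_mult:
  assumes "det A = 1" "det B = 1"
  shows "psl_class A \<otimes>\<^bsub>PSL\<^esub> psl_class B = psl_class (A ** B)"
  using normal.rcos_sum[OF scalars_normal, of A B] assms
  by (simp add: PSL_def psl_class_def)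

lemma one_PSL: "\<one>\<^bsub>PSL\<^esub> = psl_class (mat 1 :: complex^'n^'n)"
proof -
  interpret group "SL :: (complex^'n^'n) monoid" by (rule group_SL)
  have "scalars #>\<^bsub>SL\<^esub> \<one>\<^bsub>SL\<^esub> = (scalars :: (complex^'n^'n) set)"
    by (rule coset_mult_one) (auto simp: scalars_def)
  then have "psl_class (mat 1) = (scalars :: (complex^'n^'n) set)"
    by (simp only: psl_class_def SL_simps)
  then show ?thesis by (simp add: PSL_def FactGroup_def)
qed

lemma psl_class_in_PSL: "det A = 1 \<Longrightarrow> psl_class A \<in> carrier PSL"
  by (auto simp: PSL_def FactGroup_def RCOSETS_def psl_class_def)

lemma heis_class_mult: "heis_class h \<otimes>\<^bsub>PSL\<^esub> heis_class k = heis_class (hmul h k)"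
  by (cases h; cases k) (simp add: heis_class_def psl_class_mult det_heis heis_mult)

lemma heis_class_one: "heis_class (0, 0, 0) = \<one>\<^bsub>PSL\<^esub>"
  by (simp add: heis_class_def heis_0 one_PSL)

lemma heis_class_carrier: "heis_class h \<in> carrier PSL"
  by (cases h) (simp add: heis_class_def det_heis psl_class_in_PSL)

lemma heis_class_inv: "inv\<^bsub>PSL\<^esub> heis_class h = heis_class (hinv h)"
proof -
  interpret group "PSL :: (complex^3^3) set monoid" by (rule group_PSL)
  have "hmul (hinv h) h = (0, 0, 0)" by (cases h) simp
  then show ?thesis
    by (intro inv_equality) (simp_all add: heis_class_mult heis_class_one heis_class_carrier)
qed

lemma heis_eigenvector:
  assumes v: "heis a b c *v v = z *s v" "v \<noteq> 0"
  shows "z = 1"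
proof (rule ccontr)
  assume "z \<noteq> 1"
  have eq: "v $ 1 + a * v $ 2 + b * v $ 3 = z * v $ 1" "v $ 2 + c * v $ 3 = z * v $ 2" "v $ 3 = z * v $ 3"
    using v(1) unfolding heis_mult_vec by (simp_all add: vec_eq_iff forall_3)
  from eq(3) \<open>z \<noteq> 1\<close> have "v $ 3 = 0" by simp
  with eq(2) \<open>z \<noteq> 1\<close> have "v $ 2 = 0" by simp
  with eq(1) \<open>z \<noteq> 1\<close> \<open>v $ 3 = 0\<close> have "v $ 1 = 0" by simp
  with \<open>v $ 2 = 0\<close> \<open>v $ 3 = 0\<close> v(2) show False by (simp add: vec_eq_iff forall_3)
qed

lemma diagonalizable_single_eigenvalue:
  fixes A :: "complex^'n^'n"
  assumes "diagonalizable A" and eig: "\<And>z. eigenvalue A z \<Longrightarrow> z = d"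
  shows "A = mat d"
proof -
  obtain P D :: "complex^'n^'n" where P: "invertible P"
    and D: "\<And>i j. i \<noteq> j \<Longrightarrow> D $ i $ j = 0" and A: "A = P ** D ** matrix_inv P"
    using assms(1) by (auto simp: diagonalizable_def)
  have "P ** matrix_inv P = mat 1 \<and> matrix_inv P ** P = mat 1"
    using P unfolding invertible_def matrix_inv_def by (rule someI_ex)
  then have inv: "matrix_inv P ** P = mat 1" "P ** matrix_inv P = mat 1" by blast+
  have AP: "A ** P = P ** D"
    by (simp add: A inv matrix_mul_assoc[symmetric])
  have "D $ i $ i = d" for i
  proof (rule eig)
    let ?v = "P *v axis i 1"
    have "D *v axis i 1 = D $ i $ i *s axis i 1"
      using D by (simp add: matrix_vector_mult_def vec_eq_iff axis_def if_distrib cong: if_cong)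
    then have "A *v ?v = D $ i $ i *s ?v"
      by (simp add: matrix_vector_mul_assoc AP) (simp add: matrix_vector_mul_assoc[symmetric] vec.scale)
    moreover have "?v \<noteq> 0"
    proof
      assume "?v = 0"
      then have "matrix_inv P *v ?v = 0" by simp
      then have "axis i (1::complex) = 0" by (simp add: matrix_vector_mul_assoc inv)
      then show False by (simp add: axis_eq_0_iff)
    qed
    ultimately show "eigenvalue A (D $ i $ i)" unfolding eigenvalue_def by blast
  qed
  then have "D = mat d" using D by (simp add: vec_eq_iff mat_def)
  then have "A = mat d ** (P ** matrix_inv P)"
    by (simp add: A mat_mult_left mat_mult_right matrix_mul_assoc)
  then show ?thesis by (simp add: inv)
qed

text \<open>A lift is \<open>d\<close> times a unipotent matrix, with \<open>d\<^sup>3 = 1\<close>, so \<open>d\<close> is its only eigenvalue; if it were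
  diagonalizable it would be the scalar \<open>d\<close>.\<close>

lemma parabolic_heis_class:
  assumes "h \<noteq> (0, 0, 0)"
  shows "parabolic (heis_class h)"
  unfolding parabolic_def
proof (intro ballI conjI allI impI)
  obtain a b c where h: "h = (a, b, c)" by (metis prod_cases3)
  fix A assume "A \<in> heis_class h"
  then obtain d where "mat d \<in> (scalars :: (complex^3^3) set)" and A: "A = mat d ** heis a b c"
    by (auto simp: heis_class_def h mem_psl_class)
  then have d: "d ^ 3 = 1" by (simp add: scalars_def mat_def det_diagonal)
  have d0: "d \<noteq> 0" using d by auto
  have eig: "z = d" if "eigenvalue A z" for z
  proof -
    obtain v where v: "v \<noteq> 0" "A *v v = z *s v" using \<open>eigenvalue A z\<close> by (auto simp: eigenvalue_def)
    have "A *v v = d *s (heis a b c *v v)"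
      by (simp add: A matrix_vector_mul_assoc[symmetric])
        (simp add: mat_def matrix_vector_mult_def vec_eq_iff if_distrib[of "\<lambda>x. x * _"] cong: if_cong)
    then have "heis a b c *v v = (z / d) *s v"
      using v(2) d0 by (simp add: vec_eq_iff field_simps)
    then have "z / d = 1" using v(1) heis_eigenvector by blast
    then show ?thesis using d0 by simp
  qed
  {
    fix z assume "eigenvalue A z"
    then have "z ^ 3 = 1" using eig d by simp
    then have "cmod z ^ 3 = 1" by (metis norm_one norm_power)
    then show "cmod z = 1" using power_eq_imp_eq_base[of "cmod z" 3 1] by simp
  }
  show "\<not> diagonalizable A"
  proof
    assume "diagonalizable A"
    then have "A = mat d" using eig by (rule diagonalizable_single_eigenvalue)
    then have "d * heis a b c $ i $ j = mat d $ i $ j" for i j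
      using A by (simp add: mat_mult_left vec_eq_iff)
    from this[of 1 2] this[of 1 3] this[of 2 3] have "a = 0 \<and> b = 0 \<and> c = 0"
      using d0 by (simp add: heis_entries mat_def)
    with assms h show False by simp
  qed
qed

lemma purely_parabolic_Heis: "G \<subseteq> Heis \<Longrightarrow> purely_parabolic G"
  unfolding purely_parabolic_def
proof (intro ballI impI)
  fix g assume "G \<subseteq> Heis" "g \<in> G" "g \<noteq> \<one>\<^bsub>PSL\<^esub>"
  then obtain a b c where "g = psl_class (heis a b c)" unfolding Heis_def by blast
  then obtain h where h: "g = heis_class h" by (metis heis_class_def case_prod_conv)
  with \<open>g \<noteq> \<one>\<^bsub>PSL\<^esub>\<close> have "h \<noteq> (0, 0, 0)" using heis_class_one by auto
  then show "parabolic g" unfolding h by (rule parabolic_heis_class)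
qed

lemma continuous_on_if_const:
  "continuous_on S f \<Longrightarrow> continuous_on S g \<Longrightarrow> continuous_on S (\<lambda>x. if P then f x else g x)"
  by (cases P) simp_all

lemma continuous_on_heis: "continuous_on UNIV (\<lambda>(a, b, c). heis a b c)"
proof -
  have "continuous_on UNIV (\<lambda>h::triple. (\<chi> i j. if i = 1 \<and> j = 2 then fst h else if i = 1 \<and> j = 3 then fst (snd h)
      else if i = 2 \<and> j = 3 then snd (snd h) else if i = j then 1 else 0) :: complex^3^3)"
  proof (intro continuous_on_vec_lambda)
    fix i j :: 3
    show "continuous_on UNIV (\<lambda>h::triple. if i = 1 \<and> j = 2 then fst h else if i = 1 \<and> j = 3 then fst (snd h)
      else if i = 2 \<and> j = 3 then snd (snd h) else if i = j then 1 else 0)"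
      by (intro continuous_on_if_const continuous_intros)
  qed
  moreover have "(\<lambda>h::triple. (\<chi> i j. if i = 1 \<and> j = 2 then fst h else if i = 1 \<and> j = 3 then fst (snd h)
      else if i = 2 \<and> j = 3 then snd (snd h) else if i = j then 1 else 0) :: complex^3^3)
     = (\<lambda>(a, b, c). heis a b c)"
    by (rule ext) (simp add: vec_eq_iff forall_3 heis_entries split: prod.split)
  ultimately show ?thesis by (simp only:)
qed

text \<open>Some open set of \<open>PSL(3,\<complex>)\<close> meets \<open>G\<close> only in the identity; its preimage under the continuous
  parametrization by triples is a neighbourhood of \<open>0\<close>.\<close>

lemma heis_lattice_of_discrete_group:
  assumes G: "subgroup G PSL" and disc: "discrete_group G"
  shows "heis_lattice {h. heis_class h \<in> G}"
proof
  show "(0, 0, 0) \<in> {h. heis_class h \<in> G}"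
    using subgroup.one_closed[OF G] by (simp add: heis_class_one)
  show "hmul h k \<in> {h. heis_class h \<in> G}" if "h \<in> {h. heis_class h \<in> G}" "k \<in> {h. heis_class h \<in> G}" for h k
    using that subgroup.m_closed[OF G] by (simp flip: heis_class_mult)
  show "hinv h \<in> {h. heis_class h \<in> G}" if "h \<in> {h. heis_class h \<in> G}" for h
    using that subgroup.m_inv_closed[OF G] by (simp flip: heis_class_inv)
  have "openin (subtopology PSL_topology G) {\<one>\<^bsub>PSL\<^esub>}"
    using disc subgroup.one_closed[OF G] by (simp add: discrete_group_def)
  then obtain V where V: "openin PSL_topology V" "{\<one>\<^bsub>PSL\<^esub>} = V \<inter> G"
    by (auto simp: openin_subtopology)
  then have "openin (top_of_set (carrier SL)) {A \<in> carrier SL. psl_class A \<in> V}"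
    by (simp add: PSL_topology_def openin_quotient_topology)
  then obtain O' where O': "open O'" "{A \<in> carrier SL. psl_class A \<in> V} = carrier SL \<inter> O'"
    by (auto simp: openin_open)
  define W where "W = (\<lambda>(a, b, c). heis a b c) -` O'"
  have "open W" unfolding W_def using O'(1) continuous_on_heis by (rule open_vimage)
  moreover have "(0, 0, 0) \<in> W"
  proof -
    have "psl_class (mat 1) \<in> V" using V(2) by (auto simp: one_PSL)
    then have "mat 1 \<in> carrier SL \<inter> O'" unfolding O'(2)[symmetric] by simp
    then show ?thesis by (simp add: W_def heis_0)
  qed
  ultimately obtain e where e: "e > 0" "ball (0, 0, 0) e \<subseteq> W" using open_contains_ball by blast
  have "h = 0" if h: "heis_class h \<in> G" "norm h < e" for h
  proof -
    obtain a b c where abc: "h = (a, b, c)" by (metis prod_cases3)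
    have "h \<in> ball (0, 0, 0) e" using h(2) by (simp flip: zero_prod_def)
    then have "heis a b c \<in> O'" using e(2) by (auto simp: W_def abc)
    then have "heis_class h \<in> V" using O'(2) det_heis[of a b c] by (auto simp: abc heis_class_def)
    then have "heis_class h = heis_class (0, 0, 0)" using V(2) h(1) heis_class_one by auto
    then have "h = (0, 0, 0)" by (rule injD[OF inj_heis_class])
    then show ?thesis by (simp add: zero_prod_def)
  qed
  then show "discrete_at_0 {h. heis_class h \<in> G}"
    unfolding discrete_at_0_def using e(1) by blast
qed

text \<open>The point \<open>[x : y : 1]\<close>.\<close>

definition affine_point :: "complex \<times> complex \<Rightarrow> (complex^3) set" where
  "affine_point = (\<lambda>(x, y). vec.span {vector [x, y, 1]})"

lemma psl_act_affine_point: "psl_act (heis_class h) (affine_point p) = affine_point (act h p)"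
proof -
  obtain a b c x y where hp: "h = (a, b, c)" "p = (x, y)" by (metis prod_cases3 surj_pair)
  have "heis a b c *v vector [x, y, 1] = vector [x + a * y + b, y + c, 1]"
    by (simp add: heis_mult_vec)
  then have "(*v) (heis a b c) ` vec.span {vector [x, y, 1]} = vec.span {vector [x + a * y + b, y + c, 1]}"
    by (auto simp: vec.span_singleton vec.scale image_iff)
  then show ?thesis
    by (simp add: hp heis_class_def affine_point_def psl_act_psl_class)
qed

lemma continuous_map_affine_point: "continuous_map euclidean proj_space affine_point"
proof -
  have "continuous_on UNIV (\<lambda>p::complex \<times> complex. (\<chi> i. if i = 1 then fst p else if i = 2 then snd p else 1) :: complex^3)"
  proof (intro continuous_on_vec_lambda)
    fix i :: 3
    show "continuous_on UNIV (\<lambda>p::complex \<times> complex. if i = 1 then fst p else if i = 2 then snd p else 1)"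
      by (intro continuous_on_if_const continuous_intros)
  qed
  moreover have "(\<lambda>p::complex \<times> complex. (\<chi> i. if i = 1 then fst p else if i = 2 then snd p else 1) :: complex^3)
      = (\<lambda>(x, y). vector [x, y, 1])"
    by (rule ext) (simp add: vec_eq_iff forall_3 split: prod.split)
  ultimately have "continuous_on UNIV (\<lambda>(x, y). vector [x, y, 1] :: complex^3)" by (simp only:)
  then have "continuous_map euclidean (top_of_set (UNIV - {0})) (\<lambda>(x, y). vector [x, y, 1] :: complex^3)"
    by (auto simp: continuous_map_in_subtopology vec_eq_iff forall_3)
  moreover have "continuous_map (top_of_set (UNIV - {0})) proj_space (\<lambda>v::complex^3. vec.span {v})"
    unfolding proj_space_def by (intro quotient_imp_continuous_map quotient_map_quotient_topology)
  ultimately have "continuous_map euclidean proj_space ((\<lambda>v::complex^3. vec.span {v}) \<circ> (\<lambda>(x, y). vector [x, y, 1]))"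
    by (rule continuous_map_compose)
  moreover have "(\<lambda>v::complex^3. vec.span {v}) \<circ> (\<lambda>(x, y). vector [x, y, 1]) = affine_point"
    by (auto simp: affine_point_def)
  ultimately show ?thesis by simp
qed

text \<open>A nonempty open cone of vectors contains one with nonzero third coordinate.\<close>

lemma open_meets_affine_chart:
  fixes \<Omega> :: "(complex^3) set set"
  assumes "openin proj_space \<Omega>" "\<Omega> \<noteq> {}"
  shows "\<exists>p. affine_point p \<in> \<Omega>"
proof -
  define S where "S = {v \<in> UNIV - {0}. vec.span {v} \<in> \<Omega>}"
  have \<Omega>: "\<Omega> \<subseteq> (\<lambda>v. vec.span {v}) ` (UNIV - {0})" "openin (top_of_set (UNIV - {0})) S"
    using assms(1) by (simp_all add: proj_space_def openin_quotient_topology S_def)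
  have "open S" using \<Omega>(2) by (simp add: openin_open_eq open_delete)
  moreover obtain v where v: "v \<in> S" using \<Omega>(1) assms(2) by (auto simp: S_def)
  ultimately obtain e where e: "e > 0" "ball v e \<subseteq> S" using open_contains_ball by blast
  obtain w where w: "w \<in> S" "w $ 3 \<noteq> 0"
  proof (cases "v $ 3 = 0")
    case True
    let ?w = "v + axis 3 (of_real (e / 2))"
    have "dist v ?w = e / 2" using e(1)
      by (simp add: dist_norm norm_vec_def L2_set_def sum_3 axis_def)
    then have "?w \<in> S" using e by (intro subsetD[OF e(2)]) simp
    moreover have "?w $ 3 \<noteq> 0" using True e(1) by (simp add: axis_def)
    ultimately show ?thesis by (rule that)
  next
    case False
    then show ?thesis using v that by blast
  qed
  let ?u = "vector [w $ 1 / w $ 3, w $ 2 / w $ 3, 1] :: complex^3"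
  have "w = (w $ 3) *s ?u"
    using w(2) by (simp add: vec_eq_iff forall_3)
  then have "vec.span {w} = vec.span {(w $ 3) *s ?u}" by (rule arg_cong[of _ _ "\<lambda>x. vec.span {x}"])
  also have "\<dots> = vec.span {?u}"
    using w(2) vec.span_image_scale[of "{?u}" "\<lambda>_. w $ 3"] by simp
  finally have "vec.span {w} = vec.span {?u}" .
  then have "affine_point (w $ 1 / w $ 3, w $ 2 / w $ 3) \<in> \<Omega>"
    using w(1) by (simp add: S_def affine_point_def)
  then show ?thesis by blast
qed

lemma proper_heis_lattice_of_Kleinian:
  assumes G: "subgroup G PSL" and K: "complex_Kleinian G"
  shows "\<exists>U. proper_heis_lattice {h. heis_class h \<in> G} U"
proof -
  from K obtain \<Omega> where disc: "discrete_group G" and \<Omega>: "\<Omega> \<noteq> {}" "openin proj_space \<Omega>"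
    and pd: "properly_discontinuous_on G \<Omega>"
    by (auto simp: complex_Kleinian_def)
  interpret heis_lattice "{h. heis_class h \<in> G}" using G disc by (rule heis_lattice_of_discrete_group)
  have "proper_heis_lattice {h. heis_class h \<in> G} (affine_point -` \<Omega>)"
  proof
    show "open (affine_point -` \<Omega>)"
      using openin_continuous_map_preimage[OF continuous_map_affine_point \<Omega>(2)] by (simp add: vimage_def)
    show "affine_point -` \<Omega> \<noteq> {}" using open_meets_affine_chart[OF \<Omega>(2,1)] by auto
  next
    fix C assume C: "compact C" "C \<subseteq> affine_point -` \<Omega>"
    have "compactin proj_space (affine_point ` C)"
      using C(1) by (intro image_compactin[OF _ continuous_map_affine_point]) simp
    then have "finite {g \<in> G. psl_act g ` affine_point ` C \<inter> affine_point ` C \<noteq> {}}"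
      using pd C(2) by (auto simp: properly_discontinuous_on_def)
    moreover have "heis_class ` {h \<in> {h. heis_class h \<in> G}. act h ` C \<inter> C \<noteq> {}}
        \<subseteq> {g \<in> G. psl_act g ` affine_point ` C \<inter> affine_point ` C \<noteq> {}}"
    proof (rule image_subsetI)
      fix h assume h: "h \<in> {h \<in> {h. heis_class h \<in> G}. act h ` C \<inter> C \<noteq> {}}"
      then obtain p where p: "p \<in> C" "act h p \<in> C" by blast
      have "psl_act (heis_class h) (affine_point p) \<in> psl_act (heis_class h) ` affine_point ` C"
        using p(1) by (intro imageI)
      then have "affine_point (act h p) \<in> psl_act (heis_class h) ` affine_point ` C"
        by (simp only: psl_act_affine_point)
      moreover have "affine_point (act h p) \<in> affine_point ` C" using p(2) by (rule imageI)
      ultimately show "heis_class h \<in> {g \<in> G. psl_act g ` affine_point ` C \<inter> affine_point ` C \<noteq> {}}"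
        using h by blast
    qed
    ultimately have "finite (heis_class ` {h \<in> {h. heis_class h \<in> G}. act h ` C \<inter> C \<noteq> {}})"
      by (rule finite_subset[rotated])
    then show "finite {h \<in> {h. heis_class h \<in> G}. act h ` C \<inter> C \<noteq> {}}"
      by (rule finite_imageD) (rule inj_on_subset[OF inj_heis_class subset_UNIV])
  qed
  then show ?thesis by blast
qed

lemma control_kernel_eq:
  assumes "G \<subseteq> Heis"
  shows "control_kernel G = {g \<in> G. snd (snd (the_inv heis_class g)) = 0}"
proof -
  have "control g = \<one>\<^bsub>PSL\<^esub> \<longleftrightarrow> snd (snd (the_inv heis_class g)) = 0" if "g \<in> G" for g
  proof -
    obtain a b c where g: "g = heis_class (a, b, c)" using \<open>g \<in> G\<close> assms by (auto simp: Heis_def heis_class_def)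
    have "psl_class (transl c) = psl_class (mat 1) \<longleftrightarrow> c = 0"
    proof
      assume "psl_class (transl c) = psl_class (mat 1)"
      then obtain d where "transl c = mat d ** mat 1"
        using psl_class_self[of "transl c"] by (auto simp: mem_psl_class)
      then have "transl c $ 1 $ 2 = (mat d :: complex^2^2) $ 1 $ 2" by simp
      then show "c = 0" by (simp add: transl_def mat_def)
    next
      assume "c = 0"
      then have "transl c = mat 1" by (simp add: transl_def vec_eq_iff forall_2 mat_def)
      then show "psl_class (transl c) = psl_class (mat 1)" by simp
    qed
    moreover have "control g = psl_class (transl c)" unfolding g heis_class_def by (simp add: control_heis)
    ultimately show ?thesis
      by (simp add: g the_inv_f_f[OF inj_heis_class] one_PSL)
  qed
  then show ?thesis by (auto simp: control_kernel_def kernel_def)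
qed

text \<open>A trivial factor \<open>\<int>\<^sup>0\<close> is appended at the end, so that there is a factor also when \<open>G\<close> equals its control
  kernel (\<open>m = 0\<close>).\<close>

lemma decomposition_of_flags:
  fixes G :: "(complex^3^3) set set"
  assumes G: "subgroup G PSL" "G \<subseteq> Heis" and disc: "discrete_group G"
    and r: "Z_flag (heis_lattice.Ker {h. heis_class h \<in> G}) r"
    and m: "Z_flag (heis_lattice.Img {h. heis_class h \<in> G}) m"
  shows "\<exists>B. iterated_semidirect PSL (control_kernel G) B (Suc m) G \<and>
       (\<forall>i\<in>{1..Suc m}. subgroup (B i) (PSL\<lparr>carrier := G\<rparr>) \<and>
          PSL\<lparr>carrier := B i\<rparr> \<cong> Z_power (if i \<le> m then 1 else 0)) \<and>
       group_rank PSL (control_kernel G) \<le> enat r"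
proof -
  interpret P: group "PSL :: (complex^3^3) set monoid" by (rule group_PSL)
  let ?H = "{h. heis_class h \<in> G}"
  interpret heis_lattice ?H using G(1) disc by (rule heis_lattice_of_discrete_group)
  define \<phi> where "\<phi> g = snd (snd (the_inv heis_class g))" for g
  have \<phi>: "\<phi> (heis_class (a, b, c)) = c" for a b c
    by (simp add: \<phi>_def the_inv_f_f[OF inj_heis_class])
  have ex: "\<exists>a b c. g = heis_class (a, b, c)" if "g \<in> G" for g
    using that G(2) by (auto simp: Heis_def heis_class_def)
  have hom: "\<phi> (g \<otimes>\<^bsub>PSL\<^esub> k) = \<phi> g + \<phi> k" if gk: "g \<in> G" "k \<in> G" for g k
  proof -
    obtain a b c a' b' c' where "g = heis_class (a, b, c)" "k = heis_class (a', b', c')" using ex gk by metis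
    then show ?thesis by (simp add: heis_class_mult \<phi>)
  qed
  have img: "\<phi> ` G = Img"
  proof
    show "\<phi> ` G \<subseteq> Img"
    proof clarify
      fix g assume g: "g \<in> G"
      then obtain a b c where "g = heis_class (a, b, c)" using ex by blast
      with g show "\<phi> g \<in> Img" by (auto simp: \<phi> Img_def)
    qed
    show "Img \<subseteq> \<phi> ` G"
    proof
      fix c assume "c \<in> Img"
      then obtain a b where "heis_class (a, b, c) \<in> G" by (auto simp: Img_def)
      then show "c \<in> \<phi> ` G" by (metis \<phi> imageI)
    qed
  qed
  have ker: "control_kernel G = {g \<in> G. \<phi> g = 0}" using control_kernel_eq[OF G(2)] by (simp add: \<phi>_def)
  obtain B where B: "iterated_semidirect PSL (control_kernel G) B m {g \<in> G. \<phi> g \<in> Img}"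
    "\<And>i. i \<in> {1..m} \<Longrightarrow> subgroup (B i) (PSL\<lparr>carrier := G\<rparr>) \<and> PSL\<lparr>carrier := B i\<rparr> \<cong> Z_power 1"
    using P.Z_flag_imp_iterated_semidirect[OF G(1) hom m] img ker by auto
  have "{g \<in> G. \<phi> g \<in> Img} = G" using img by blast
  with B(1) have "iterated_semidirect PSL (control_kernel G) B m G" by simp
  then have "iterated_semidirect PSL (control_kernel G) (B(Suc m := {\<one>\<^bsub>PSL\<^esub>})) m G"
    by (subst iterated_semidirect_cong[of m _ B]) simp_all
  then have it: "iterated_semidirect PSL (control_kernel G) (B(Suc m := {\<one>\<^bsub>PSL\<^esub>})) (Suc m) G"
    using P.semidirect_trivial[OF G(1)] by auto
  have fac: "subgroup ((B(Suc m := {\<one>\<^bsub>PSL\<^esub>})) i) (PSL\<lparr>carrier := G\<rparr>) \<and>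
      PSL\<lparr>carrier := (B(Suc m := {\<one>\<^bsub>PSL\<^esub>})) i\<rparr> \<cong> Z_power (if i \<le> m then 1 else 0)"
    if i: "i \<in> {1..Suc m}" for i
  proof (cases "i = Suc m")
    case True
    have "subgroup {\<one>\<^bsub>PSL\<^esub>} (PSL\<lparr>carrier := G\<rparr>)"
      using group.triv_subgroup[OF P.subgroup_imp_group[OF G(1)]] by simp
    moreover have "(if i \<le> m then 1 else 0) = (0::nat)" using True by simp
    ultimately show ?thesis
      unfolding True fun_upd_same using P.Z_power_0 by simp
  next
    case False
    with i have im: "i \<in> {1..m}" by simp
    then have "(if i \<le> m then 1 else 0) = (1::nat)" by simp
    with B(2)[OF im] show ?thesis unfolding fun_upd_other[OF False] by metis
  qed
  have "control_kernel G = (\<lambda>(a, b). heis_class (a, b, 0)) ` Ker"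
  proof
    show "control_kernel G \<subseteq> (\<lambda>(a, b). heis_class (a, b, 0)) ` Ker"
    proof
      fix g assume g: "g \<in> control_kernel G"
      then obtain a b c where abc: "g = heis_class (a, b, c)" using ex ker by blast
      with g ker \<phi> have "c = 0" by auto
      with abc g ker show "g \<in> (\<lambda>(a, b). heis_class (a, b, 0)) ` Ker" by (auto simp: Ker_def)
    qed
    show "(\<lambda>(a, b). heis_class (a, b, 0)) ` Ker \<subseteq> control_kernel G"
      using ker \<phi> by (auto simp: Ker_def)
  qed
  moreover have "group_rank PSL ((\<lambda>(a, b). heis_class (a, b, 0)) ` Ker) \<le> enat r"
    using r by (rule P.group_rank_le_of_Z_flag) (auto simp: heis_class_carrier heis_class_mult)
  ultimately have "group_rank PSL (control_kernel G) \<le> enat r" by (simp only:)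
  with it fac show ?thesis by (intro exI[of _ "B(Suc m := {\<one>\<^bsub>PSL\<^esub>})"]) blast
qed

theorem theorem0p3:
  fixes G :: "(complex^3^3) set set"
  assumes "subgroup G PSL" and "G \<subseteq> Heis" and "discrete_group G"
  shows "purely_parabolic G \<and>
    (\<exists>(n::nat) (B :: nat \<Rightarrow> (complex^3^3) set set) (k :: nat \<Rightarrow> nat).
       n \<ge> 1 \<and>
       iterated_semidirect PSL (control_kernel G) B n G \<and>
       (\<forall>i\<in>{1..n}. subgroup (B i) (PSL\<lparr>carrier := G\<rparr>) \<and> PSL\<lparr>carrier := B i\<rparr> \<cong> Z_power (k i)) \<and>
       group_rank PSL (control_kernel G) + enat (\<Sum>i=1..n. k i) \<le> 6 \<and>
       (complex_Kleinian G \<longrightarrow>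
         group_rank PSL (control_kernel G) + enat (\<Sum>i=1..n. k i) \<le> 4))"
proof -
  interpret heis_lattice "{h. heis_class h \<in> G}"
    using assms(1,3) by (rule heis_lattice_of_discrete_group)
  obtain r m where flags: "Z_flag Ker r" "Z_flag Img m"
    and bounds: "r + m \<le> 6" "complex_Kleinian G \<longrightarrow> r + m \<le> 4"
  proof (cases "complex_Kleinian G")
    case True
    then obtain U where "proper_heis_lattice {h. heis_class h \<in> G} U"
      using proper_heis_lattice_of_Kleinian[OF assms(1)] by blast
    from proper_heis_lattice.rank_bound_proper[OF this] show ?thesis using that by force
  next
    case False
    then show ?thesis using rank_bound that by blast
  qed
  obtain B where B: "iterated_semidirect PSL (control_kernel G) B (Suc m) G"
    "\<forall>i\<in>{1..Suc m}. subgroup (B i) (PSL\<lparr>carrier := G\<rparr>) \<and>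
       PSL\<lparr>carrier := B i\<rparr> \<cong> Z_power (if i \<le> m then 1 else 0)"
    and rank: "group_rank PSL (control_kernel G) \<le> enat r"
    using decomposition_of_flags[OF assms flags] by blast
  have "(\<Sum>i=1..Suc m. if i \<le> m then 1 else 0) = m" by simp
  with rank have "group_rank PSL (control_kernel G) + enat (\<Sum>i=1..Suc m. if i \<le> m then 1 else 0) \<le> enat (r + m)"
    by (metis add_right_mono plus_enat_simps(1))
  moreover have "enat (r + m) \<le> 6" "complex_Kleinian G \<Longrightarrow> enat (r + m) \<le> 4"
    using bounds by (simp_all add: numeral_eq_enat)
  ultimately show ?thesis
    using B purely_parabolic_Heis[OF assms(2)] 
    by (intro conjI exI[of _ "Suc m"] exI[of _ B] exI[of _ "\<lambda>i. if i \<le> m then 1 else 0"]) auto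
qed

end
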